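(* Let $d\ge 2$, let $a,b$ be real numbers with $0<a<b$, and let $p\in\,]0,1[$. Define $\nu=(1-p)\delta_a+p\,\delta_b$ and $\mu=\nu^{\otimes E}$, where $E$ is the set of edges of $\mathbb{Z}^d$. Then there exist two positive constants $C_1$ and $C_2$ such that, for any vertex $v\in\mathbb{Z}^d$ with $|v|\ge 2$ and any positive real number $t$, $$\mu\left(\left|d_x(0,v)-\int d_x(0,v)\,d\mu(x)\right|> t\sqrt{\frac{|v|}{\log |v|}}\right)\le C_1e^{-C_2t}.$$
   Context: $\mathbb{Z}^d$ is the nearest-neighbour lattice and $|\cdot|$ denotes the $L^1$-norm of vertices. $\delta_a$ is the Dirac mass at $a$. For $x=(x_e)_{e\in E}\in\mathbb{R}_+^E$ and vertices $u,v$, the first passage time is $d_x(u,v)=\inf_{\alpha}\sum_{e\in\alpha}x_e$, the infimum being over all paths $\alpha$ with end points $u$ and $v$. *)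

theory Defs
  imports "HOL-Probability.Probability"
begin

text \<open>Vertices of the lattice are elements of \<open>int ^ 'd\<close>, the dimension being \<open>CARD('d)\<close>.\<close>

definition l1_norm :: "int ^ 'd::finite \<Rightarrow> int" where
  "l1_norm v = (\<Sum>i\<in>UNIV. \<bar>v $ i\<bar>)"

definition lattice_edges :: "(int ^ 'd::finite) set set" where
  "lattice_edges = {{u, w} | u w. l1_norm (u - w) = 1}"

definition lattice_path :: "int ^ 'd::finite \<Rightarrow> int ^ 'd \<Rightarrow> (int ^ 'd) list \<Rightarrow> bool" where
  "lattice_path u v ws \<longleftrightarrow>
     ws \<noteq> [] \<and> hd ws = u \<and> last ws = v \<and> successively (\<lambda>y z. {y, z} \<in> lattice_edges) ws"

fun path_edges :: "'v list \<Rightarrow> 'v set list" where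
  "path_edges (y # z # ws) = {y, z} # path_edges (z # ws)"
| "path_edges _ = []"

text \<open>
  Paths may revisit vertices, and an edge is then counted with multiplicity. Since passage times
  are nonnegative, erasing loops shows that the infimum over self-avoiding paths is the same.
\<close>

definition first_passage_time ::
    "((int ^ 'd::finite) set \<Rightarrow> real) \<Rightarrow> int ^ 'd \<Rightarrow> int ^ 'd \<Rightarrow> real" where
  "first_passage_time x u v =
     (INF ws\<in>{ws. lattice_path u v ws}. sum_list (map x (path_edges ws)))"

abbreviation nonneg_borel :: "real measure" where
  "nonneg_borel \<equiv> restrict_space borel {0..}"

text \<open>
  \<open>two_point_measure a b p\<close> is $(1-p)\delta_a + p\,\delta_b$ on the Borel sets of the nonnegative
  reals, for $a, b \ge 0$ and $0 \le p \le 1$.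
\<close>

definition two_point_measure :: "real \<Rightarrow> real \<Rightarrow> real \<Rightarrow> real measure" where
  "two_point_measure a b p = measure_of {0..} (sets nonneg_borel)
     (\<lambda>A. ennreal (1 - p) * emeasure (return nonneg_borel a) A
          + ennreal p * emeasure (return nonneg_borel b) A)"

definition edge_measure ::
    "real \<Rightarrow> real \<Rightarrow> real \<Rightarrow> ((int ^ 'd::finite) set \<Rightarrow> real) measure" where
  "edge_measure a b p = PiM lattice_edges (\<lambda>_. two_point_measure a b p)"

text \<open>
  The remaining facts show that \<open>measure_of\<close> yields the intended probability measure and that
  passage times are bounded random variables, so that neither the probability nor the expectation
  of interest takes a default value.
\<close>

lemma space_two_point_measure: "space (two_point_measure a b p) = {0..}"
  and sets_two_point_measure: "sets (two_point_measure a b p) = sets nonneg_borel"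
proof -
  have sp: "space nonneg_borel = {0..}" by (simp add: space_restrict_space)
  have "sets nonneg_borel \<subseteq> Pow {0..}"
    using sets.space_closed[of nonneg_borel] unfolding sp .
  then show "space (two_point_measure a b p) = {0..}"
    and "sets (two_point_measure a b p) = sets nonneg_borel"
    unfolding two_point_measure_def
    using sets.sigma_sets_eq[of nonneg_borel] sp by simp_all
qed

lemma emeasure_two_point_measure:
  assumes "A \<in> sets nonneg_borel"
  shows "emeasure (two_point_measure a b p) A
           = ennreal (1 - p) * indicator A a + ennreal p * indicator A b"
proof -
  let ?f = "\<lambda>A. ennreal (1 - p) * emeasure (return nonneg_borel a) A
          + ennreal p * emeasure (return nonneg_borel b) A"
  have "countably_additive (sets nonneg_borel) ?f"
  proof (rule countably_additiveI)
    fix F :: "nat \<Rightarrow> real set"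
    assume F: "range F \<subseteq> sets nonneg_borel" "disjoint_family F"
    have "(\<Sum>i. emeasure (return nonneg_borel c) (F i))
            = emeasure (return nonneg_borel c) (\<Union>i. F i)" for c
      using F by (intro suminf_emeasure) auto
    then show "(\<Sum>i. ?f (F i)) = ?f (\<Union>i. F i)"
      by (simp add: suminf_add[symmetric] ennreal_suminf_cmult)
  qed
  then have "emeasure (two_point_measure a b p) A = ?f A"
    using assms
    using sets.space_closed[of nonneg_borel]
    by (intro emeasure_measure_of[OF two_point_measure_def])
       (auto simp: sets_two_point_measure space_restrict_space positive_def)
  with assms show ?thesis by simp
qed

lemma prob_space_two_point_measure:
  assumes "0 \<le> a" "0 \<le> b" "0 \<le> p" "p \<le> 1"
  shows "prob_space (two_point_measure a b p)"
proof
  have "{0..} \<in> sets nonneg_borel"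
    using sets.top[of nonneg_borel] by (simp add: space_restrict_space)
  then show "emeasure (two_point_measure a b p) (space (two_point_measure a b p)) = 1"
    using assms
    by (simp add: space_two_point_measure emeasure_two_point_measure ennreal_plus[symmetric]
             del: ennreal_plus)
qed

lemma prob_space_edge_measure:
  assumes "0 \<le> a" "0 \<le> b" "0 \<le> p" "p \<le> 1"
  shows "prob_space (edge_measure a b p)"
  unfolding edge_measure_def
  by (intro prob_space_PiM prob_space_two_point_measure assms)

lemma path_edges_in_lattice_edges:
  "successively (\<lambda>y z. {y, z} \<in> lattice_edges) ws \<Longrightarrow> set (path_edges ws) \<subseteq> lattice_edges"
  by (induction ws rule: path_edges.induct) auto

lemma measurable_edge_weight:
  fixes e :: "(int ^ 'd::finite) set"
  assumes "e \<in> lattice_edges"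
  shows "(\<lambda>x. x e) \<in> borel_measurable (edge_measure a b p)"
proof -
  have "(\<lambda>x. x e) \<in> measurable (edge_measure a b p) (two_point_measure a b p)"
    unfolding edge_measure_def by (rule measurable_component_singleton[OF assms])
  then have "(\<lambda>x. x e) \<in> measurable (edge_measure a b p) nonneg_borel"
    by (simp add: sets_two_point_measure cong: measurable_cong_sets)
  then show ?thesis
    by (simp add: measurable_restrict_space2_iff)
qed

lemma measurable_path_sum:
  "set es \<subseteq> lattice_edges \<Longrightarrow>
     (\<lambda>x. sum_list (map x es)) \<in> borel_measurable (edge_measure a b p)"
  by (induction es) (auto intro!: borel_measurable_add measurable_edge_weight)

lemma path_sum_nonneg:
  assumes "x \<in> space (edge_measure a b p)" "lattice_path u v ws"
  shows "0 \<le> sum_list (map x (path_edges ws))"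
proof -
  have "set (path_edges ws) \<subseteq> lattice_edges"
    using assms(2) path_edges_in_lattice_edges unfolding lattice_path_def by blast
  then show ?thesis
    using assms(1)
    by (intro sum_list_nonneg)
       (auto simp: edge_measure_def space_PiM space_two_point_measure PiE_def Pi_def)
qed

lemma lattice_path_exists: "\<exists>ws. lattice_path (u :: int ^ 'd::finite) v ws"
proof (induction "nat (l1_norm (u - v))" arbitrary: u rule: less_induct)
  case less
  show ?case
  proof (cases "u = v")
    case True
    then have "lattice_path u v [u]" by (simp add: lattice_path_def)
    then show ?thesis ..
  next
    case False
    then obtain i where i: "u $ i \<noteq> v $ i" by (auto simp: vec_eq_iff)
    define s where "s = sgn (v $ i - u $ i)"
    define w where "w = u + axis i s"
    have s: "\<bar>s\<bar> = 1" "\<bar>u $ i + s - v $ i\<bar> = \<bar>u $ i - v $ i\<bar> - 1"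
      using i unfolding s_def by (auto simp: sgn_if)
    have split: "l1_norm z = \<bar>z $ i\<bar> + (\<Sum>j\<in>UNIV - {i}. \<bar>z $ j\<bar>)" for z :: "int ^ 'd"
      unfolding l1_norm_def by (simp add: sum.remove[of UNIV i])
    have "l1_norm (u - w) = 1"
      unfolding split using s(1) by (simp add: w_def axis_def)
    then have e: "{u, w} \<in> lattice_edges" unfolding lattice_edges_def by blast
    have "l1_norm (w - v) = l1_norm (u - v) - 1"
      unfolding split using s(2) by (simp add: w_def axis_def)
    moreover have "0 < l1_norm (u - v)"
      unfolding split using i by (intro add_pos_nonneg sum_nonneg) auto
    ultimately have "nat (l1_norm (w - v)) < nat (l1_norm (u - v))" by simp
    from less[OF this] obtain ws where "lattice_path w v ws" ..
    with e have "lattice_path u v (u # ws)"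
      unfolding lattice_path_def by (auto simp: successively_Cons)
    then show ?thesis ..
  qed
qed

lemma measurable_first_passage_time:
  "(\<lambda>x. first_passage_time x u v) \<in> borel_measurable (edge_measure a b p)"
  unfolding first_passage_time_def
proof (rule borel_measurable_cINF)
  show "countable {ws. lattice_path u v ws}"
    by (rule countableI_type)
  show "(\<lambda>x. sum_list (map x (path_edges ws))) \<in> borel_measurable (edge_measure a b p)"
    if "ws \<in> {ws. lattice_path u v ws}" for ws
    using that path_edges_in_lattice_edges
    by (intro measurable_path_sum) (auto simp: lattice_path_def)
  show "bdd_below ((\<lambda>ws. sum_list (map x (path_edges ws))) ` {ws. lattice_path u v ws})"
    if "x \<in> space (edge_measure a b p)" for x
    using path_sum_nonneg[OF that] by (intro bdd_belowI2[where m=0]) auto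
qed

lemma AE_edge_weight_le:
  fixes e :: "(int ^ 'd::finite) set"
  assumes "0 \<le> a" "0 \<le> b" "0 \<le> p" "p \<le> 1" "e \<in> lattice_edges"
  shows "AE x in edge_measure a b p. x e \<le> max a b"
proof -
  let ?N = "two_point_measure a b p"
  have set: "{max a b<..} \<in> sets nonneg_borel"
    using assms by (auto simp: sets_restrict_space_iff)
  have "AE y in ?N. y \<le> max a b"
    by (rule AE_I[where N="{max a b<..}"])
       (use set in \<open>auto simp: emeasure_two_point_measure sets_two_point_measure indicator_def\<close>)
  then show ?thesis
    unfolding edge_measure_def
    by (intro AE_PiM_component assms prob_space_two_point_measure)
qed

lemma integrable_first_passage_time:
  fixes u v :: "int ^ 'd::finite"
  assumes "0 \<le> a" "0 \<le> b" "0 \<le> p" "p \<le> 1"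
  shows "integrable (edge_measure a b p) (\<lambda>x. first_passage_time x u v)"
proof -
  interpret prob_space "edge_measure a b p :: ((int ^ 'd) set \<Rightarrow> real) measure"
    by (rule prob_space_edge_measure[OF assms])
  obtain ws where ws: "lattice_path u v ws" using lattice_path_exists by blast
  have sub: "set (path_edges ws) \<subseteq> lattice_edges"
    using ws path_edges_in_lattice_edges unfolding lattice_path_def by blast
  have "AE x in edge_measure a b p. \<forall>e\<in>set (path_edges ws). x e \<le> max a b"
    using sub AE_edge_weight_le[OF assms] by (intro AE_finite_allI) auto
  then have "AE x in edge_measure a b p.
      norm (first_passage_time x u v) \<le> real (length (path_edges ws)) * max a b"
  proof (rule AE_mp, intro AE_I2 impI)
    fix x :: "(int ^ 'd) set \<Rightarrow> real"
    assume x: "x \<in> space (edge_measure a b p)"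
      and le: "\<forall>e\<in>set (path_edges ws). x e \<le> max a b"
    have "0 \<le> first_passage_time x u v"
      unfolding first_passage_time_def using ws path_sum_nonneg[OF x]
      by (intro cINF_greatest) auto
    moreover have "first_passage_time x u v \<le> sum_list (map x (path_edges ws))"
      unfolding first_passage_time_def using ws path_sum_nonneg[OF x]
      by (intro cINF_lower bdd_belowI2[where m=0]) auto
    moreover have "sum_list (map x (path_edges ws))
        \<le> sum_list (map (\<lambda>_. max a b) (path_edges ws))"
      using le by (intro sum_list_mono) auto
    ultimately show "norm (first_passage_time x u v) \<le> real (length (path_edges ws)) * max a b"
      by (simp add: sum_list_triv)
  qed
  then show ?thesis
    by (rule integrable_const_bound[OF _ measurable_first_passage_time])
qed

end

theory Submission
  imports Defs
begin

text \<open>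
  The concentration on the scale \<open>sqrt (n / ln n)\<close>, where \<open>n\<close> is the norm of the end point \<open>v\<close>,
  beats the scale \<open>sqrt n\<close> of the Efron--Stein inequality by a logarithm. The gain comes from the
  fact that the passage time depends on many edges, each of which has a small influence.

  A geodesic has at most \<open>b * n / a\<close> edges, so the passage time is a function of the weights of
  finitely many edges, that is, of the random set \<open>A\<close> of edges of weight \<open>b\<close> in a finite set \<open>S\<close>.
  Up to the final transfer to the infinite product measure (\<open>integral_configuration\<close>) the argument
  lives on the biased cube \<open>Pow S\<close>.

  The analytic tool is an inequality of Falik and Samorodnitsky (\<open>modified_Poincare\<close>):
  \<open>L * Var f\<close> is at most twice the Dirichlet energy of \<open>f\<close> plus \<open>exp L\<close> times the sum of the
  squared \<open>L\<^sup>1\<close>-influences. It follows from the logarithmic Sobolev inequality applied to the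
  martingale differences of \<open>f\<close>. If all influences are at most \<open>\<delta>\<close>, the choice \<open>exp L = 1 / \<delta>\<close>
  improves the Poincare inequality by the factor \<open>ln (1 / \<delta>)\<close>.

  The influences of the passage time itself are large near the end points. Following Benjamini, Kalai
  and Schramm it is therefore replaced by the average \<open>F\<close> of the passage times from \<open>z\<close> to \<open>v + z\<close>,
  where \<open>z\<close> runs over a planar box \<open>Z\<close> of side \<open>m\<close>, about \<open>n\<close> to the power \<open>1/4\<close>. This changes
  the passage time by \<open>O(m)\<close> only, which is below the scale \<open>sqrt (n / ln n)\<close>. By translation
  invariance the influence of an edge on \<open>F\<close> is governed by the expected number of vertices that a
  single geodesic has in a reflected translate of \<open>Z\<close>. That number is \<open>O(m)\<close>, since a segment of a
  geodesic is no longer than \<open>b / a\<close> times the distance of its ends. Since \<open>Z\<close> has \<open>m * m\<close> points,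
  influences are \<open>O(1 / m)\<close> (\<open>influence_le\<close>); this is where dimension at least two enters.

  Following Benaim and Rossignol, the inequality is applied not to \<open>F\<close> but to \<open>exp (s * F)\<close>
  (\<open>exp_variance_bound\<close>). The resulting variance bound compares the moment generating function of
  \<open>F\<close> at \<open>2 * s\<close> with its square at \<open>s\<close>, and iterating it along \<open>s / 2 ^ k\<close> bounds the exponential
  moment of the centred \<open>F\<close> at a fixed multiple of \<open>sqrt (ln n / n)\<close> (\<open>exp_moment_bound\<close>).
  Chernoff's inequality then gives the tail.
\<close>

section \<open>Functional inequalities on the biased cube\<close>

locale bernoulli_cube =
  fixes p :: real
  assumes p_pos: "0 < p" and p_less_1: "p < 1"
begin

text \<open>
  The expectation of \<open>h\<close> at a random subset of \<open>S\<close> that contains each element of \<open>S\<close>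
  independently with probability \<open>p\<close>. A finite sum rather than a measure, so that neither
  measurability nor integrability enters the inductions over \<open>S\<close>.
\<close>
definition E :: "'e set \<Rightarrow> ('e set \<Rightarrow> real) \<Rightarrow> real" where
  "E S h = (\<Sum>A\<in>Pow S. p ^ card A * (1 - p) ^ card (S - A) * h A)"

text \<open>
  The influence of \<open>e\<close> on \<open>h\<close> when the rest of the configuration \<open>A\<close> is fixed. The value is the
  same for \<open>insert e A\<close> and \<open>A - {e}\<close>, which is what allows resampling \<open>e\<close> independently of it.
\<close>
definition D :: "'e \<Rightarrow> ('e set \<Rightarrow> real) \<Rightarrow> 'e set \<Rightarrow> real" where
  "D e h A = h (insert e A) - h (A - {e})"

text \<open>
  Conditioning on the coordinate \<open>e\<close>. The functional inequalities are proved by induction over \<open>S\<close>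
  with this identity.
\<close>
lemma E_insert:
  assumes "finite S" "e \<notin> S"
  shows "E (insert e S) h = (1 - p) * E S h + p * E S (\<lambda>A. h (insert e A))"
proof -
  let ?w = "\<lambda>S A. p ^ card A * (1 - p) ^ card (S - A)"
  have inj: "inj_on (insert e) (Pow S)"
    using assms(2) by (auto simp: inj_on_def)
  have disj: "Pow S \<inter> insert e ` Pow S = {}"
    using assms(2) by auto
  have w0: "?w (insert e S) A = (1 - p) * ?w S A" if "A \<in> Pow S" for A
  proof -
    have "insert e S - A = insert e (S - A)" using that assms(2) by auto
    then show ?thesis using assms by simp
  qed
  have w1: "?w (insert e S) (insert e A) = p * ?w S A" if "A \<in> Pow S" for A
  proof -
    have "insert e S - insert e A = S - A" "e \<notin> A" "finite A"
      using that assms by (auto intro: finite_subset)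
    then show ?thesis by simp
  qed
  have "E (insert e S) h = (\<Sum>A\<in>Pow S. ?w (insert e S) A * h A)
      + (\<Sum>A\<in>Pow S. ?w (insert e S) (insert e A) * h (insert e A))"
    unfolding E_def Pow_insert
    by (subst sum.union_disjoint) (use assms(1) disj inj in \<open>auto simp: sum.reindex\<close>)
  also have "\<dots> = (\<Sum>A\<in>Pow S. (1 - p) * ?w S A * h A)
      + (\<Sum>A\<in>Pow S. p * ?w S A * h (insert e A))"
    using w0 w1 by (intro arg_cong2[of _ _ _ _ "(+)"] sum.cong) auto
  finally show ?thesis
    by (simp add: E_def sum_distrib_left mult.assoc)
qed

lemma E_empty [simp]: "E {} h = h {}"
  by (simp add: E_def)

lemma E_add: "E S (\<lambda>A. f A + g A) = E S f + E S g"
  by (simp add: E_def algebra_simps sum.distrib)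

lemma E_cmult: "E S (\<lambda>A. c * f A) = c * E S f"
  by (simp add: E_def sum_distrib_left algebra_simps)

lemma E_diff: "E S (\<lambda>A. f A - g A) = E S f - E S g"
  by (simp add: E_def algebra_simps sum_subtractf)

lemma E_sum: "E S (\<lambda>A. \<Sum>i\<in>I. f i A) = (\<Sum>i\<in>I. E S (f i))"
  unfolding E_def sum_distrib_left by (rule sum.swap)

lemma E_mono: "(\<And>A. A \<subseteq> S \<Longrightarrow> f A \<le> g A) \<Longrightarrow> E S f \<le> E S g"
  unfolding E_def using p_pos p_less_1 by (intro sum_mono mult_left_mono) auto

lemma E_cong: "(\<And>A. A \<subseteq> S \<Longrightarrow> f A = g A) \<Longrightarrow> E S f = E S g"
  unfolding E_def by (intro sum.cong) auto

lemma E_nonneg: "(\<And>A. A \<subseteq> S \<Longrightarrow> 0 \<le> f A) \<Longrightarrow> 0 \<le> E S f"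
  unfolding E_def using p_pos p_less_1 by (intro sum_nonneg) auto

lemma E_const: "finite S \<Longrightarrow> E S (\<lambda>A. c) = c"
  by (induction S rule: finite_induct) (auto simp: E_insert algebra_simps)

lemma E_abs: "\<bar>E S f\<bar> \<le> E S (\<lambda>A. \<bar>f A\<bar>)"
proof -
  have "E S f \<le> E S (\<lambda>A. \<bar>f A\<bar>)" by (rule E_mono) simp
  moreover have "E S (\<lambda>A. -1 * f A) \<le> E S (\<lambda>A. \<bar>f A\<bar>)" by (rule E_mono) simp
  ultimately show ?thesis unfolding E_cmult by simp
qed

text \<open>
  The weight \<open>h\<close> is kept general because \<open>exp_variance_bound\<close> takes the influence of an edge as
  the weight.
\<close>
lemma E_Cauchy_Schwarz:
  assumes "\<And>A. A \<subseteq> S \<Longrightarrow> 0 \<le> h A"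
  shows "(E S (\<lambda>A. h A * f A * g A))\<^sup>2 \<le> E S (\<lambda>A. h A * (f A)\<^sup>2) * E S (\<lambda>A. h A * (g A)\<^sup>2)"
proof -
  let ?w = "\<lambda>A. p ^ card A * (1 - p) ^ card (S - A) * h A"
  have w: "0 \<le> ?w A" if "A \<in> Pow S" for A
    using that assms p_pos p_less_1 by auto
  have "(\<Sum>A\<in>Pow S. (sqrt (?w A) * f A) * (sqrt (?w A) * g A))\<^sup>2
      \<le> (\<Sum>A\<in>Pow S. (sqrt (?w A) * f A)\<^sup>2) * (\<Sum>A\<in>Pow S. (sqrt (?w A) * g A)\<^sup>2)"
    by (rule Cauchy_Schwarz_ineq_sum)
  moreover have "(\<Sum>A\<in>Pow S. (sqrt (?w A) * f A) * (sqrt (?w A) * g A))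
      = E S (\<lambda>A. h A * f A * g A)"
    unfolding E_def
  proof (rule sum.cong[OF refl])
    fix A assume "A \<in> Pow S"
    then have "sqrt (?w A) * sqrt (?w A) = ?w A" by (rule real_sqrt_mult_self[THEN trans, OF abs_of_nonneg[OF w]])
    then have "(sqrt (?w A) * sqrt (?w A)) * (f A * g A) = ?w A * (f A * g A)"
      by (rule arg_cong)
    then show "sqrt (?w A) * f A * (sqrt (?w A) * g A)
        = p ^ card A * (1 - p) ^ card (S - A) * (h A * f A * g A)"
      by (simp only: mult.assoc mult.left_commute)
  qed
  moreover have "(\<Sum>A\<in>Pow S. (sqrt (?w A) * f A)\<^sup>2) = E S (\<lambda>A. h A * (f A)\<^sup>2)" for f
    unfolding E_def
    by (rule sum.cong[OF refl], subst power_mult_distrib, subst real_sqrt_pow2)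
      (use w in \<open>auto simp: mult.assoc\<close>)
  ultimately show ?thesis by simp
qed

text \<open>
  The value \<open>ln 0 = 0\<close> agrees here with the convention that \<open>0 * ln 0\<close> vanishes, so \<open>Ent\<close> is the
  usual entropy also when \<open>h\<close> has zeros.
\<close>
definition Ent :: "'e set \<Rightarrow> ('e set \<Rightarrow> real) \<Rightarrow> real" where
  "Ent S h = E S (\<lambda>A. h A * ln (h A)) - E S h * ln (E S h)"

definition energy :: "'e set \<Rightarrow> ('e set \<Rightarrow> real) \<Rightarrow> real" where
  "energy S f = (\<Sum>e\<in>S. E S (\<lambda>A. (D e f A)\<^sup>2))"

text \<open>
  Since \<open>ln r \<le> r - 1\<close>, the entropy of a nonnegative variable is at most its variance divided by
  its mean. For the square of a variable with the values \<open>x\<close> and \<open>y\<close> the variance has the factor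
  \<open>(x - y)\<^sup>2 * (x + y)\<^sup>2\<close>, and the mean \<open>m\<close> absorbs \<open>p * (1 - p) * (x + y)\<^sup>2\<close> up to the constant \<open>2\<close>.
\<close>
lemma two_point_log_Sobolev:
  fixes x y :: real
  assumes "0 \<le> x" "0 \<le> y"
  defines "m \<equiv> (1 - p) * x\<^sup>2 + p * y\<^sup>2"
  shows "(1 - p) * (x\<^sup>2 * ln (x\<^sup>2)) + p * (y\<^sup>2 * ln (y\<^sup>2)) - m * ln m \<le> 2 * (x - y)\<^sup>2"
proof (cases "x = 0 \<and> y = 0")
  case True
  then show ?thesis by (simp add: m_def)
next
  case False
  have m0: "0 < m"
  proof -
    have "0 \<le> (1 - p) * x\<^sup>2" "0 \<le> p * y\<^sup>2"
      using p_pos p_less_1 by auto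
    moreover have "(1 - p) * x\<^sup>2 \<noteq> 0 \<or> p * y\<^sup>2 \<noteq> 0"
      using False p_pos p_less_1 by auto
    ultimately show ?thesis unfolding m_def by linarith
  qed
  have ln: "u * ln u \<le> u * ln m + u * (u / m - 1)" if "0 \<le> u" for u
  proof (cases "u = 0")
    case False
    then have "0 < u" using that by simp
    then have "ln (u / m) \<le> u / m - 1" using m0 by (intro ln_le_minus_one) simp
    then have "ln u \<le> ln m + (u / m - 1)" using \<open>0 < u\<close> m0 by (simp add: ln_div)
    then show ?thesis using that by (metis mult_left_mono distrib_left)
  qed simp
  have "(1 - p) * (x\<^sup>2 * ln (x\<^sup>2)) + p * (y\<^sup>2 * ln (y\<^sup>2))
     \<le> (1 - p) * (x\<^sup>2 * ln m + x\<^sup>2 * (x\<^sup>2 / m - 1)) + p * (y\<^sup>2 * ln m + y\<^sup>2 * (y\<^sup>2 / m - 1))"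
    using p_pos p_less_1 by (intro add_mono mult_left_mono ln) auto
  also have "\<dots> = m * ln m + p * (1 - p) * (x\<^sup>2 - y\<^sup>2)\<^sup>2 / m"
  proof -
    have "((1 - p) * (x\<^sup>2 * (x\<^sup>2 / m - 1)) + p * (y\<^sup>2 * (y\<^sup>2 / m - 1))) * m
        = (1 - p) * (x\<^sup>2)\<^sup>2 + p * (y\<^sup>2)\<^sup>2 - m * m"
    proof -
      have *: "(u / m - 1) * m = u - m" for u using m0 by (simp add: field_simps)
      have "((1 - p) * (x\<^sup>2 * (x\<^sup>2 / m - 1)) + p * (y\<^sup>2 * (y\<^sup>2 / m - 1))) * m
          = (1 - p) * (x\<^sup>2 * ((x\<^sup>2 / m - 1) * m)) + p * (y\<^sup>2 * ((y\<^sup>2 / m - 1) * m))"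
        by (simp only: distrib_right mult.assoc)
      also have "\<dots> = (1 - p) * (x\<^sup>2)\<^sup>2 + p * (y\<^sup>2)\<^sup>2 - m * ((1 - p) * x\<^sup>2 + p * y\<^sup>2)"
        unfolding * by (simp add: power2_eq_square algebra_simps)
      finally show ?thesis unfolding m_def .
    qed
    also have "\<dots> = p * (1 - p) * (x\<^sup>2 - y\<^sup>2)\<^sup>2"
      unfolding m_def by (simp add: algebra_simps power2_eq_square)
    finally have *: "(1 - p) * (x\<^sup>2 * (x\<^sup>2 / m - 1)) + p * (y\<^sup>2 * (y\<^sup>2 / m - 1))
        = p * (1 - p) * (x\<^sup>2 - y\<^sup>2)\<^sup>2 / m"
      using m0 by (simp add: field_simps)
    have "(1 - p) * (x\<^sup>2 * ln m) + p * (y\<^sup>2 * ln m) = m * ln m"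
      unfolding m_def by (simp add: algebra_simps)
    with * show ?thesis by (simp add: algebra_simps)
  qed
  also have "p * (1 - p) * (x\<^sup>2 - y\<^sup>2)\<^sup>2 / m \<le> 2 * (x - y)\<^sup>2"
  proof -
    have "p * (1 - p) * (x + y)\<^sup>2 \<le> 2 * (p * (1 - p) * (x\<^sup>2 + y\<^sup>2))"
    proof -
      have "0 \<le> (x - y)\<^sup>2" by simp
      then have "(x + y)\<^sup>2 \<le> 2 * (x\<^sup>2 + y\<^sup>2)" by (simp add: power2_eq_square algebra_simps)
      moreover have "0 \<le> p * (1 - p)" using p_pos p_less_1 by simp
      ultimately have "p * (1 - p) * (x + y)\<^sup>2 \<le> p * (1 - p) * (2 * (x\<^sup>2 + y\<^sup>2))"
        by (rule mult_left_mono)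
      then show ?thesis by (simp add: algebra_simps)
    qed
    also have "p * (1 - p) * (x\<^sup>2 + y\<^sup>2) \<le> m"
    proof -
      have "p * ((1 - p) * x\<^sup>2) \<le> 1 * ((1 - p) * x\<^sup>2)"
        using p_less_1 by (intro mult_right_mono) auto
      moreover have "(1 - p) * (p * y\<^sup>2) \<le> 1 * (p * y\<^sup>2)"
        using p_pos by (intro mult_right_mono) auto
      ultimately show ?thesis unfolding m_def by (simp add: algebra_simps)
    qed
    finally have "p * (1 - p) * (x + y)\<^sup>2 * (x - y)\<^sup>2 \<le> 2 * m * (x - y)\<^sup>2"
      by (intro mult_right_mono) auto
    moreover have "(x\<^sup>2 - y\<^sup>2)\<^sup>2 = (x + y)\<^sup>2 * (x - y)\<^sup>2"
      by (simp add: power2_eq_square algebra_simps)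
    ultimately show ?thesis using m0 by (simp add: field_simps)
  qed
  finally show ?thesis by simp
qed

lemma D_insert:
  "e \<noteq> e' \<Longrightarrow> D e' f (insert e A) = D e' (\<lambda>A. f (insert e A)) A"
  unfolding D_def by (simp add: insert_commute insert_Diff_if)

lemma D_insert_same: "D e f (insert e A) = D e f A"
  by (simp add: D_def)

lemma D_notin: "e \<notin> A \<Longrightarrow> D e f A = f (insert e A) - f A"
  by (simp add: D_def)

lemma energy_insert:
  assumes "finite S" "e \<notin> S"
  shows "energy (insert e S) f
    = (1 - p) * energy S f + p * energy S (\<lambda>A. f (insert e A))
      + E S (\<lambda>A. (f (insert e A) - f A)\<^sup>2)"
proof -
  have "E (insert e S) (\<lambda>A. (D e f A)\<^sup>2) = E S (\<lambda>A. (D e f A)\<^sup>2)"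
    using assms by (simp add: E_insert D_insert_same algebra_simps)
  also have "\<dots> = E S (\<lambda>A. (f (insert e A) - f A)\<^sup>2)"
    using assms(2) by (intro E_cong arg_cong[of _ _ "\<lambda>r. r\<^sup>2"] D_notin) auto
  finally have 1: "E (insert e S) (\<lambda>A. (D e f A)\<^sup>2) = E S (\<lambda>A. (f (insert e A) - f A)\<^sup>2)" .
  have "(\<Sum>e'\<in>S. E (insert e S) (\<lambda>A. (D e' f A)\<^sup>2))
      = (\<Sum>e'\<in>S. (1 - p) * E S (\<lambda>A. (D e' f A)\<^sup>2)
          + p * E S (\<lambda>A. (D e' (\<lambda>A. f (insert e A)) A)\<^sup>2))"
  proof (rule sum.cong[OF refl])
    fix e' assume "e' \<in> S"
    then have "e \<noteq> e'" using assms(2) by auto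
    then show "E (insert e S) (\<lambda>A. (D e' f A)\<^sup>2) = (1 - p) * E S (\<lambda>A. (D e' f A)\<^sup>2)
          + p * E S (\<lambda>A. (D e' (\<lambda>A. f (insert e A)) A)\<^sup>2)"
      using assms by (simp add: E_insert D_insert)
  qed
  then show ?thesis
    using assms 1 by (simp add: energy_def sum.distrib sum_distrib_left)
qed

text \<open>
  When \<open>e\<close> is added to \<open>S\<close>, the entropy of \<open>f\<^sup>2\<close> is the mean of its entropies given the coordinate \<open>e\<close>
  plus the two-point entropy of the squares of the two conditional \<open>L\<^sup>2\<close>-norms. By Cauchy--Schwarz
  the difference of these norms is at most the norm of the difference, which is the contribution
  of \<open>e\<close> to the energy.
\<close>
theorem log_Sobolev:
  assumes "finite S"
  shows "Ent S (\<lambda>A. (f A)\<^sup>2) \<le> 2 * energy S f"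
  using assms
proof (induction S arbitrary: f rule: finite_induct)
  case empty
  show ?case by (simp add: Ent_def energy_def)
next
  case (insert e S)
  define f1 where "f1 = (\<lambda>A. f (insert e A))"
  define u0 where "u0 = E S (\<lambda>A. (f A)\<^sup>2)"
  define u1 where "u1 = E S (\<lambda>A. (f1 A)\<^sup>2)"
  define m where "m = (1 - p) * u0 + p * u1"
  have u: "0 \<le> u0" "0 \<le> u1" unfolding u0_def u1_def by (auto intro: E_nonneg)
  have "Ent (insert e S) (\<lambda>A. (f A)\<^sup>2)
      = (1 - p) * Ent S (\<lambda>A. (f A)\<^sup>2) + p * Ent S (\<lambda>A. (f1 A)\<^sup>2)
        + ((1 - p) * (u0 * ln u0) + p * (u1 * ln u1) - m * ln m)"
    using insert.hyps unfolding Ent_def u0_def u1_def m_def f1_def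
    by (simp add: E_insert algebra_simps)
  also have "\<dots> \<le> (1 - p) * (2 * energy S f) + p * (2 * energy S f1)
        + 2 * E S (\<lambda>A. (f1 A - f A)\<^sup>2)"
  proof (intro add_mono mult_left_mono insert.IH)
    have "(1 - p) * (u0 * ln u0) + p * (u1 * ln u1) - m * ln m \<le> 2 * (sqrt u0 - sqrt u1)\<^sup>2"
      using two_point_log_Sobolev[of "sqrt u0" "sqrt u1"] u by (simp add: m_def)
    also have "(sqrt u0 - sqrt u1)\<^sup>2 = u0 + u1 - 2 * (sqrt u0 * sqrt u1)"
      using u by (simp add: power2_diff)
    also have "\<dots> \<le> u0 + u1 - 2 * E S (\<lambda>A. f A * f1 A)"
    proof -
      have "(E S (\<lambda>A. f A * f1 A))\<^sup>2 \<le> u0 * u1"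
        using E_Cauchy_Schwarz[of S "\<lambda>_. 1" f f1] by (simp add: u0_def u1_def)
      then have "E S (\<lambda>A. f A * f1 A) \<le> sqrt (u0 * u1)" by (rule real_le_rsqrt)
      then show ?thesis by (simp add: real_sqrt_mult)
    qed
    also have "\<dots> = E S (\<lambda>A. (f1 A - f A)\<^sup>2)"
    proof -
      have "(\<lambda>A. (f1 A - f A)\<^sup>2) = (\<lambda>A. ((f A)\<^sup>2 + (f1 A)\<^sup>2) - 2 * (f A * f1 A))"
        by (simp add: power2_diff algebra_simps)
      then show ?thesis unfolding u0_def u1_def by (simp add: E_diff E_add E_cmult)
    qed
    finally show "(1 - p) * (u0 * ln u0) + p * (u1 * ln u1) - m * ln m
        \<le> 2 * E S (\<lambda>A. (f1 A - f A)\<^sup>2)" by simp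
  qed (use p_pos p_less_1 in auto)
  also have "\<dots> = 2 * energy (insert e S) f"
    using insert.hyps by (simp add: energy_insert f1_def algebra_simps)
  finally show ?case .
qed

text \<open>
  A function whose \<open>L\<^sup>1\<close>-norm is much smaller than its \<open>L\<^sup>2\<close>-norm has large entropy. The proof
  estimates \<open>ln r\<close> from below by \<open>1 - ln u - 1 / (r * u)\<close>, where \<open>r\<close> is the absolute value of \<open>V\<close>
  and \<open>u\<close> a free parameter.
\<close>
lemma entropy_lower_bound:
  assumes "finite S"
  shows "L * E S (\<lambda>A. (V A)\<^sup>2) - exp L * (E S (\<lambda>A. \<bar>V A\<bar>))\<^sup>2 \<le> Ent S (\<lambda>A. (V A)\<^sup>2)"
proof -
  define x where "x = E S (\<lambda>A. (V A)\<^sup>2)"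
  define y where "y = E S (\<lambda>A. \<bar>V A\<bar>)"
  have y2: "y\<^sup>2 \<le> x"
    using E_Cauchy_Schwarz[of S "\<lambda>_. 1" "\<lambda>A. \<bar>V A\<bar>" "\<lambda>_. 1"] assms
    by (simp add: x_def y_def E_const)
  have x0: "0 \<le> x" unfolding x_def by (auto intro: E_nonneg)
  have y0: "0 \<le> y" unfolding y_def by (auto intro: E_nonneg)
  have lower: "x * (2 - 2 * ln u) - 2 * y / u \<le> E S (\<lambda>A. (V A)\<^sup>2 * ln ((V A)\<^sup>2))"
    if u: "0 < u" for u
  proof -
    have "x * (2 - 2 * ln u) - 2 * y / u = E S (\<lambda>A. (2 - 2 * ln u) * (V A)\<^sup>2 - (2 / u) * \<bar>V A\<bar>)"
      unfolding x_def y_def E_diff E_cmult by (simp add: algebra_simps)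
    also have "\<dots> \<le> E S (\<lambda>A. (V A)\<^sup>2 * ln ((V A)\<^sup>2))"
    proof (rule E_mono)
      fix A
      show "(2 - 2 * ln u) * (V A)\<^sup>2 - (2 / u) * \<bar>V A\<bar> \<le> (V A)\<^sup>2 * ln ((V A)\<^sup>2)"
      proof (cases "V A = 0")
        case False
        define r where "r = \<bar>V A\<bar>"
        have r: "0 < r" "(V A)\<^sup>2 = r\<^sup>2" using False by (auto simp: r_def)
        have "ln (1 / (r * u)) \<le> 1 / (r * u) - 1"
          using r u by (intro ln_le_minus_one) simp
        then have "1 - ln u - 1 / (r * u) \<le> ln r"
          using r u by (simp add: ln_div ln_mult)
        then have "2 * r\<^sup>2 * (1 - ln u - 1 / (r * u)) \<le> 2 * r\<^sup>2 * ln r"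
          using r by (intro mult_left_mono) auto
        moreover have "2 * r\<^sup>2 * (1 - ln u - 1 / (r * u)) = (2 - 2 * ln u) * r\<^sup>2 - (2 / u) * r"
          using r u by (simp add: field_simps power2_eq_square)
        moreover have "ln (r\<^sup>2) = 2 * ln r" using r by (simp add: ln_realpow)
        ultimately show ?thesis unfolding r(2) r_def[symmetric] by (simp add: mult.assoc mult.left_commute)
      qed simp
    qed
    finally show ?thesis .
  qed
  show ?thesis
  proof (cases "x = 0")
    case True
    then have "y = 0" using y2 by simp
    then show ?thesis
      using lower[of 1] True unfolding Ent_def x_def[symmetric] y_def[symmetric] by simp
  next
    case False
    then have x: "0 < x" using x0 by simp
    \<comment> \<open>Then \<open>- 2 * ln u = L + ln x\<close>, and \<open>ln x\<close> cancels against the second term of the entropy.\<close>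
    define u where "u = 1 / (exp (L / 2) * sqrt x)"
    have u: "0 < u" using x by (simp add: u_def)
    have lnu: "2 * ln u = - L - ln x"
      using x by (simp add: u_def ln_div ln_mult ln_sqrt)
    have "2 * y / u = 2 * (exp (L / 2) * y) * sqrt x"
      by (simp add: u_def)
    also have "\<dots> \<le> (exp (L / 2) * y)\<^sup>2 + (sqrt x)\<^sup>2"
      by (rule sum_squares_bound)
    also have "\<dots> = exp L * y\<^sup>2 + x"
      using x by (simp add: power_mult_distrib exp_double[symmetric])
    finally have "2 * y / u \<le> exp L * y\<^sup>2 + x" .
    moreover have "x * (2 - 2 * ln u) = 2 * x + L * x + x * ln x"
      unfolding lnu by (simp add: algebra_simps)
    ultimately show ?thesis
      using lower[OF u] x unfolding Ent_def x_def[symmetric] y_def[symmetric] by simp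
  qed
qed

definition Var :: "'e set \<Rightarrow> ('e set \<Rightarrow> real) \<Rightarrow> real" where
  "Var S f = E S (\<lambda>A. (f A)\<^sup>2) - (E S f)\<^sup>2"

text \<open>
  Let \<open>h\<close> be the average of \<open>f\<close> over the coordinate \<open>e\<close> and \<open>V = f - h\<close>, the martingale difference
  of \<open>e\<close>. The variance and the energy of \<open>f\<close> are the sums of those of \<open>h\<close> and of \<open>V\<close>. The induction
  hypothesis bounds the part of \<open>h\<close>, whose influences are no larger than those of \<open>f\<close>. The part of
  \<open>V\<close> is bounded by comparing the logarithmic Sobolev inequality with \<open>entropy_lower_bound\<close>, where
  the \<open>L\<^sup>1\<close>-norm of \<open>V\<close> is at most the influence of \<open>e\<close>.
\<close>
theorem modified_Poincare:
  assumes "finite S"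
  shows "L * Var S f \<le> 2 * energy S f + exp L * (\<Sum>e\<in>S. (E S (\<lambda>A. \<bar>D e f A\<bar>))\<^sup>2)"
  using assms
proof (induction S arbitrary: f rule: finite_induct)
  case empty
  show ?case by (simp add: Var_def energy_def)
next
  case (insert e S)
  define g where "g = (\<lambda>A. f (insert e A) - f A)"
  define h where "h = (\<lambda>A. (1 - p) * f A + p * f (insert e A))"
  \<comment> \<open>The difference of \<open>f\<close> and its average over the coordinate \<open>e\<close>, in terms of the derivative \<open>g\<close>.\<close>
  define V where "V = (\<lambda>A. (if e \<in> A then 1 - p else - p) * g (A - {e}))"
  let ?q = "p * (1 - p)"
  have q: "0 \<le> ?q" "2 * ?q \<le> 1"
  proof -
    show "0 \<le> ?q" using p_pos p_less_1 by simp
    have "0 \<le> (2 * p - 1)\<^sup>2" by simp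
    then show "2 * ?q \<le> 1" by (simp add: power2_eq_square algebra_simps)
  qed
  have V0: "V A = - p * g A" and V1: "V (insert e A) = (1 - p) * g A" if "A \<subseteq> S" for A
    using that insert.hyps(2) by (auto simp: V_def insert_Diff_if subset_eq)
  have EV: "E (insert e S) (\<lambda>A. \<phi> (V A))
      = (1 - p) * E S (\<lambda>A. \<phi> (- p * g A)) + p * E S (\<lambda>A. \<phi> ((1 - p) * g A))" for \<phi> :: "real \<Rightarrow> real"
  proof -
    have "E S (\<lambda>A. \<phi> (V A)) = E S (\<lambda>A. \<phi> (- p * g A))"
      by (rule E_cong) (simp add: V0)
    moreover have "E S (\<lambda>A. \<phi> (V (insert e A))) = E S (\<lambda>A. \<phi> ((1 - p) * g A))"
      by (rule E_cong) (simp add: V1)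
    ultimately show ?thesis using insert.hyps by (simp add: E_insert)
  qed
  have EV2: "E (insert e S) (\<lambda>A. (V A)\<^sup>2) = ?q * E S (\<lambda>A. (g A)\<^sup>2)"
    unfolding EV[of "\<lambda>r. r\<^sup>2"] power_mult_distrib E_cmult
    by (simp add: power2_eq_square algebra_simps)
  have EV1: "E (insert e S) (\<lambda>A. \<bar>V A\<bar>) = 2 * ?q * E S (\<lambda>A. \<bar>g A\<bar>)"
    unfolding EV[of abs] abs_mult E_cmult using p_pos p_less_1
    by (simp add: algebra_simps)
  have var: "Var (insert e S) f = Var S h + E (insert e S) (\<lambda>A. (V A)\<^sup>2)"
  proof -
    have "E (insert e S) f = E S h"
      using insert.hyps by (simp add: E_insert h_def E_add E_cmult)
    moreover have "E (insert e S) (\<lambda>A. (f A)\<^sup>2) = E S (\<lambda>A. (h A)\<^sup>2) + ?q * E S (\<lambda>A. (g A)\<^sup>2)"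
      using insert.hyps unfolding E_insert[OF insert.hyps] E_cmult[symmetric] E_add[symmetric]
      by (intro E_cong) (simp add: h_def g_def power2_eq_square algebra_simps)
    ultimately show ?thesis by (simp add: Var_def EV2)
  qed
  have D_h: "D e' h A = (1 - p) * D e' f A + p * D e' (\<lambda>A. f (insert e A)) A" for e' A
    by (simp add: D_def h_def algebra_simps)
  have D_g: "D e' g A = D e' (\<lambda>A. f (insert e A)) A - D e' f A" for e' A
    by (simp add: D_def g_def algebra_simps)
  have energy_V: "energy (insert e S) V = ?q * energy S g + E S (\<lambda>A. (g A)\<^sup>2)"
  proof -
    have "E S (\<lambda>A. (V (insert e A) - V A)\<^sup>2) = E S (\<lambda>A. (g A)\<^sup>2)"
      by (intro E_cong) (simp add: V0 V1 algebra_simps)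
    moreover have "energy S V = p\<^sup>2 * energy S g"
      unfolding energy_def sum_distrib_left E_cmult[symmetric]
    proof (intro sum.cong refl E_cong)
      fix e' A assume "e' \<in> S" "A \<subseteq> S"
      then have "insert e' A \<subseteq> S" "A - {e'} \<subseteq> S" by auto
      then have "D e' V A = - p * D e' g A"
        by (simp add: D_def V0 algebra_simps)
      then show "(D e' V A)\<^sup>2 = p\<^sup>2 * (D e' g A)\<^sup>2" by (simp add: power_mult_distrib)
    qed
    moreover have "energy S (\<lambda>A. V (insert e A)) = (1 - p)\<^sup>2 * energy S g"
      unfolding energy_def sum_distrib_left E_cmult[symmetric]
    proof (intro sum.cong refl E_cong)
      fix e' A assume "e' \<in> S" "A \<subseteq> S"
      then have "insert e' A \<subseteq> S" "A - {e'} \<subseteq> S" by auto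
      then have "D e' (\<lambda>A. V (insert e A)) A = (1 - p) * D e' g A"
        by (simp add: D_def V1 algebra_simps)
      then show "(D e' (\<lambda>A. V (insert e A)) A)\<^sup>2 = (1 - p)\<^sup>2 * (D e' g A)\<^sup>2"
        by (simp add: power_mult_distrib)
    qed
    ultimately have "energy (insert e S) V = (1 - p) * (p\<^sup>2 * energy S g)
        + p * ((1 - p)\<^sup>2 * energy S g) + E S (\<lambda>A. (g A)\<^sup>2)"
      unfolding energy_insert[OF insert.hyps] by simp
    then show ?thesis by (simp add: power2_eq_square algebra_simps)
  qed
  have energy: "energy (insert e S) f = energy S h + energy (insert e S) V"
  proof -
    have "(1 - p) * energy S f + p * energy S (\<lambda>A. f (insert e A)) = energy S h + ?q * energy S g"
      unfolding energy_def sum_distrib_left E_cmult[symmetric] E_add[symmetric] sum.distrib[symmetric]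
      by (intro sum.cong refl E_cong) (simp add: D_h D_g power2_eq_square algebra_simps)
    then show ?thesis
      unfolding energy_V unfolding energy_insert[OF insert.hyps] by (simp add: g_def)
  qed
  have l1: "(\<Sum>e'\<in>S. (E S (\<lambda>A. \<bar>D e' h A\<bar>))\<^sup>2) + (E (insert e S) (\<lambda>A. \<bar>V A\<bar>))\<^sup>2
      \<le> (\<Sum>e'\<in>insert e S. (E (insert e S) (\<lambda>A. \<bar>D e' f A\<bar>))\<^sup>2)"
  proof -
    have "E (insert e S) (\<lambda>A. \<bar>D e f A\<bar>) = E S (\<lambda>A. \<bar>D e f A\<bar>)"
      using insert.hyps by (simp add: E_insert D_insert_same algebra_simps)
    also have "\<dots> = E S (\<lambda>A. \<bar>g A\<bar>)"
      unfolding g_def using insert.hyps(2) by (intro E_cong arg_cong[of _ _ abs] D_notin) auto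
    finally have De: "E (insert e S) (\<lambda>A. \<bar>D e f A\<bar>) = E S (\<lambda>A. \<bar>g A\<bar>)" .
    have g0: "0 \<le> E S (\<lambda>A. \<bar>g A\<bar>)" by (rule E_nonneg) simp
    have "2 * ?q * E S (\<lambda>A. \<bar>g A\<bar>) \<le> 1 * E S (\<lambda>A. \<bar>g A\<bar>)"
      using q g0 by (intro mult_right_mono) auto
    then have "(E (insert e S) (\<lambda>A. \<bar>V A\<bar>))\<^sup>2 \<le> (E (insert e S) (\<lambda>A. \<bar>D e f A\<bar>))\<^sup>2"
      unfolding De EV1 using q g0 by (intro power_mono) auto
    moreover have "(E S (\<lambda>A. \<bar>D e' h A\<bar>))\<^sup>2 \<le> (E (insert e S) (\<lambda>A. \<bar>D e' f A\<bar>))\<^sup>2"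
      if "e' \<in> S" for e'
    proof -
      have "E S (\<lambda>A. \<bar>D e' h A\<bar>)
          \<le> E S (\<lambda>A. (1 - p) * \<bar>D e' f A\<bar> + p * \<bar>D e' (\<lambda>A. f (insert e A)) A\<bar>)"
      proof (rule E_mono)
        fix A
        show "\<bar>D e' h A\<bar> \<le> (1 - p) * \<bar>D e' f A\<bar> + p * \<bar>D e' (\<lambda>A. f (insert e A)) A\<bar>"
          unfolding D_h using p_pos p_less_1 by (intro order_trans[OF abs_triangle_ineq]) (simp add: abs_mult)
      qed
      also have "\<dots> = E (insert e S) (\<lambda>A. \<bar>D e' f A\<bar>)"
      proof -
        have "e \<noteq> e'" using that insert.hyps(2) by auto
        then show ?thesis using insert.hyps by (simp add: E_insert E_add E_cmult D_insert)
      qed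
      finally show ?thesis by (intro power_mono E_nonneg) auto
    qed
    ultimately show ?thesis
      using insert.hyps by (simp add: add.commute add_mono sum_mono)
  qed
  have "L * Var (insert e S) f = L * Var S h + L * E (insert e S) (\<lambda>A. (V A)\<^sup>2)"
    by (simp add: var algebra_simps)
  also have "\<dots> \<le> (2 * energy S h + exp L * (\<Sum>e'\<in>S. (E S (\<lambda>A. \<bar>D e' h A\<bar>))\<^sup>2))
      + (2 * energy (insert e S) V + exp L * (E (insert e S) (\<lambda>A. \<bar>V A\<bar>))\<^sup>2)"
  proof (intro add_mono insert.IH)
    have fin: "finite (insert e S)" using insert.hyps by simp
    show "L * E (insert e S) (\<lambda>A. (V A)\<^sup>2)
        \<le> 2 * energy (insert e S) V + exp L * (E (insert e S) (\<lambda>A. \<bar>V A\<bar>))\<^sup>2"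
      using log_Sobolev[OF fin, of V] entropy_lower_bound[OF fin, of L V] by linarith
  qed
  also have "\<dots> = 2 * energy (insert e S) f
      + exp L * ((\<Sum>e'\<in>S. (E S (\<lambda>A. \<bar>D e' h A\<bar>))\<^sup>2) + (E (insert e S) (\<lambda>A. \<bar>V A\<bar>))\<^sup>2)"
    by (simp add: energy algebra_simps)
  also have "\<dots> \<le> 2 * energy (insert e S) f
      + exp L * (\<Sum>e'\<in>insert e S. (E (insert e S) (\<lambda>A. \<bar>D e' f A\<bar>))\<^sup>2)"
    using l1 by (intro add_left_mono mult_left_mono) auto
  finally show ?case .
qed

end

section \<open>Exponential moments and small influences\<close>

lemma exp_le_quadratic:
  fixes x :: real
  assumes "\<bar>x\<bar> \<le> 1"
  shows "exp x \<le> 1 + x + x\<^sup>2"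
proof (cases "0 \<le> x")
  case True
  then show ?thesis using assms by (intro exp_bound) auto
next
  case False
  define y where "y = - x"
  have y: "0 < y" using False by (simp add: y_def)
  have "1 \<le> (1 - y + y\<^sup>2) * (1 + y)"
    using y by (simp add: power2_eq_square algebra_simps)
  also have "\<dots> \<le> (1 - y + y\<^sup>2) * exp y"
  proof (rule mult_left_mono)
    have "0 \<le> (1 - y)\<^sup>2 + y" using y by simp
    then show "0 \<le> 1 - y + y\<^sup>2" using y by (simp add: power2_eq_square algebra_simps)
  qed (rule exp_ge_add_one_self)
  finally have "exp (- y) \<le> 1 - y + y\<^sup>2"
    by (simp add: exp_minus field_simps)
  then show ?thesis by (simp add: y_def)
qed

text \<open>
  The point \<open>z\<close> is either of the two arguments, because a configuration may be either of the two
  states compared by \<open>D\<close>.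
\<close>
lemma abs_exp_diff_le:
  fixes x y z :: real
  assumes "\<bar>x - y\<bar> \<le> 1" "z = x \<or> z = y"
  shows "\<bar>exp x - exp y\<bar> \<le> 3 * \<bar>x - y\<bar> * exp z"
proof -
  have *: "exp x - exp y \<le> (x - y) * exp x" if "y \<le> x" for x y :: real
  proof -
    have "(1 + (y - x)) * exp x \<le> exp (y - x) * exp x"
      by (intro mult_right_mono exp_ge_add_one_self) simp
    then show ?thesis by (simp add: exp_diff algebra_simps)
  qed
  have "\<bar>exp x - exp y\<bar> \<le> \<bar>x - y\<bar> * exp (max x y)"
    using *[of x y] *[of y x] by (cases "x \<le> y") (auto simp: max_def)
  also have "\<dots> \<le> \<bar>x - y\<bar> * (3 * exp z)"
  proof (rule mult_left_mono)
    have "exp (max x y) \<le> exp (1 + z)" using assms by auto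
    also have "\<dots> \<le> 3 * exp z" unfolding exp_add by (intro mult_right_mono exp_le) simp
    finally show "exp (max x y) \<le> 3 * exp z" .
  qed simp
  finally show ?thesis by simp
qed

context bernoulli_cube
begin

text \<open>
  If adding \<open>e\<close> increases \<open>h\<close> by at most a factor, one may restrict to configurations that omit \<open>e\<close>,
  at the cost of a constant. In these \<open>e\<close> has the lower weight, and raising it affects the passage
  time only if every geodesic uses \<open>e\<close>.
\<close>
lemma E_le_E_absent:
  assumes "finite S" "1 \<le> c"
    and nonneg: "\<And>A. A \<subseteq> S \<Longrightarrow> 0 \<le> h A"
    and flip: "\<And>A. A \<subseteq> S \<Longrightarrow> h A \<le> c * h (A - {e})"
  shows "E S h \<le> c / (1 - p) * E S (\<lambda>A. if e \<in> A then 0 else h A)"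
proof (cases "e \<in> S")
  case True
  define S' where "S' = S - {e}"
  have S: "S = insert e S'" "finite S'" "e \<notin> S'"
    using True assms(1) by (auto simp: S'_def)
  have "E S' (\<lambda>A. h (insert e A)) \<le> E S' (\<lambda>A. c * h A)"
  proof (rule E_mono)
    fix A assume A: "A \<subseteq> S'"
    then have "insert e A - {e} = A" using S(3) by auto
    then show "h (insert e A) \<le> c * h A" using flip[of "insert e A"] A S by auto
  qed
  moreover have "0 \<le> E S' h" using nonneg S by (intro E_nonneg) auto
  ultimately have "E S h \<le> (1 - p) * (c * E S' h) + p * (c * E S' h)"
    unfolding S(1) E_insert[OF S(2,3)] using assms(2) p_pos p_less_1
    by (intro add_mono mult_left_mono) (auto simp: E_cmult mult_le_cancel_right1)
  also have "\<dots> = c / (1 - p) * ((1 - p) * E S' h)" using p_less_1 by (simp add: field_simps)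
  also have "(1 - p) * E S' h = E S (\<lambda>A. if e \<in> A then 0 else h A)"
  proof -
    have "E S' (\<lambda>A. if e \<in> A then 0 else h A) = E S' h"
      using S(3) by (intro E_cong) auto
    then show ?thesis unfolding S(1) E_insert[OF S(2,3)] using E_const[OF S(2), of 0] by simp
  qed
  finally show ?thesis .
next
  case False
  have "E S (\<lambda>A. if e \<in> A then 0 else h A) = E S h"
    using False by (intro E_cong) auto
  moreover have "1 \<le> c / (1 - p)" using assms(2) p_pos p_less_1 by (simp add: field_simps)
  moreover have "0 \<le> E S h" using nonneg by (rule E_nonneg)
  ultimately show ?thesis using mult_right_mono[of 1 "c / (1 - p)" "E S h"] by simp
qed

lemma E_superset:
  assumes "finite S" "S' \<subseteq> S" and dep: "\<And>A. h (A \<inter> S') = h A"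
  shows "E S h = E S' h"
proof -
  have fin: "finite S'" using assms finite_subset by blast
  have "E (T \<union> S') h = E S' h" if "finite T" for T
    using that
  proof induction
    case (insert t T)
    show ?case
    proof (cases "t \<in> T \<union> S'")
      case True
      then have "insert t T \<union> S' = T \<union> S'" by auto
      then show ?thesis using insert.IH by simp
    next
      case False
      have "h (insert t A) = h A" for A
      proof -
        have "insert t A \<inter> S' = A \<inter> S'" using False by auto
        then show ?thesis by (metis dep)
      qed
      then show ?thesis
        using False insert fin by (simp add: E_insert algebra_simps)
    qed
  qed simp
  from this[OF assms(1)] show ?thesis using assms(2) by (simp add: Un_absorb2)
qed

lemma E_vimage:
  assumes "bij \<pi>"
  shows "E S (\<lambda>A. h (\<pi> -` A)) = E (\<pi> -` S) h"
proof -
  have c: "card (\<pi> -` A) = card A" for A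
    using assms by (intro card_vimage_inj) (auto simp: bij_def)
  have im: "Pow (\<pi> -` S) = (\<lambda>A. \<pi> -` A) ` Pow S"
  proof (intro equalityI subsetI)
    fix B assume B: "B \<in> Pow (\<pi> -` S)"
    have "B = \<pi> -` (\<pi> ` B)" using assms by (simp add: bij_def inj_vimage_image_eq)
    moreover have "\<pi> ` B \<in> Pow S" using B by auto
    ultimately show "B \<in> (\<lambda>A. \<pi> -` A) ` Pow S" by blast
  qed auto
  have inj: "inj_on (\<lambda>A. \<pi> -` A) (Pow S)"
    using assms by (intro inj_onI) (metis bij_is_surj surj_image_vimage_eq)
  show ?thesis
    unfolding E_def im sum.reindex[OF inj]
    by (simp add: c vimage_Diff[symmetric])
qed

text \<open>
  By the mean value theorem the influences of \<open>G = exp (s * F)\<close> are at most \<open>3 * \<bar>s\<bar> * D e F * G\<close>.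
  Everything is then expressed by the expectations of \<open>D e F * G\<^sup>2\<close>: in the energy one factor \<open>D e F\<close> is
  bounded by \<open>c\<close>, and Cauchy--Schwarz with the weight \<open>D e F\<close> bounds the squared \<open>L\<^sup>1\<close>-influence of
  \<open>e\<close> on \<open>G\<close> by \<open>\<delta>\<close> times this expectation. The sum over \<open>e\<close> is bounded pointwise by \<open>N\<close> once it is
  restricted to absent \<open>e\<close>.
\<close>
theorem exp_variance_bound:
  assumes fin: "finite S"
    and D_nonneg: "\<And>e A. e \<in> S \<Longrightarrow> A \<subseteq> S \<Longrightarrow> 0 \<le> D e F A"
    and D_le: "\<And>e A. e \<in> S \<Longrightarrow> A \<subseteq> S \<Longrightarrow> D e F A \<le> c"
    and total: "\<And>A. A \<subseteq> S \<Longrightarrow> (\<Sum>e\<in>S - A. D e F A) \<le> N"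
    and influence: "\<And>e. e \<in> S \<Longrightarrow> E S (D e F) \<le> \<delta>"
    and nonneg: "0 \<le> c" "0 \<le> \<delta>"
    and s: "\<bar>s\<bar> * c \<le> 1"
  shows "L * Var S (\<lambda>A. exp (s * F A))
    \<le> 81 * N / (1 - p) * (2 * c + exp L * \<delta>) * s\<^sup>2 * E S (\<lambda>A. exp (2 * s * F A))"
proof -
  define G where "G = (\<lambda>A. exp (s * F A))"
  define Q where "Q = E S (\<lambda>A. (G A)\<^sup>2)"
  have G2: "(G A)\<^sup>2 = exp (2 * s * F A)" for A
    by (simp add: G_def exp_double[symmetric] mult.assoc)
  have step: "\<bar>s * F (insert e A) - s * F (A - {e})\<bar> = \<bar>s\<bar> * D e F A"
    "\<bar>s * F (insert e A) - s * F (A - {e})\<bar> \<le> 1" if "e \<in> S" "A \<subseteq> S" for e A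
  proof -
    have "\<bar>s * F (insert e A) - s * F (A - {e})\<bar> = \<bar>s\<bar> * \<bar>D e F A\<bar>"
      by (simp add: D_def abs_mult[symmetric] right_diff_distrib)
    then show *: "\<bar>s * F (insert e A) - s * F (A - {e})\<bar> = \<bar>s\<bar> * D e F A"
      using D_nonneg[OF that] by simp
    have "\<bar>s\<bar> * D e F A \<le> \<bar>s\<bar> * c" using D_le[OF that] by (intro mult_left_mono) auto
    then show "\<bar>s * F (insert e A) - s * F (A - {e})\<bar> \<le> 1" using * s by simp
  qed
  have DG: "\<bar>D e G A\<bar> \<le> 3 * \<bar>s\<bar> * (D e F A * G A)" if "e \<in> S" "A \<subseteq> S" for e A
  proof -
    have "A = insert e A \<or> A = A - {e}" by auto
    then have "s * F A = s * F (insert e A) \<or> s * F A = s * F (A - {e})" by metis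
    from abs_exp_diff_le[OF step(2)[OF that] this] show ?thesis
      unfolding step(1)[OF that] by (simp add: D_def G_def algebra_simps)
  qed
  have sum_DF: "(\<Sum>e\<in>S. E S (\<lambda>A. D e F A * (G A)\<^sup>2)) \<le> 9 * N / (1 - p) * Q"
  proof -
    have "E S (\<lambda>A. D e F A * (G A)\<^sup>2)
        \<le> 9 / (1 - p) * E S (\<lambda>A. if e \<in> A then 0 else D e F A * (G A)\<^sup>2)" if e: "e \<in> S" for e
    proof (rule E_le_E_absent[OF fin])
      fix A assume A: "A \<subseteq> S"
      show "0 \<le> D e F A * (G A)\<^sup>2" using D_nonneg[OF e A] by simp
      have "A = insert e A \<or> A = A - {e}" by auto
      then have "s * F A \<le> s * F (A - {e}) + 1"
        using step(2)[OF e A] by (metis abs_le_D1 add.commute diff_le_eq le_add_same_cancel1 zero_le_one)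
      then have "(G A)\<^sup>2 \<le> exp (2 * s * F (A - {e}) + 2)" unfolding G2 by simp
      also have "\<dots> = (exp 1)\<^sup>2 * (G (A - {e}))\<^sup>2"
        unfolding G2 exp_add by (simp add: exp_double[symmetric])
      also have "\<dots> \<le> 3\<^sup>2 * (G (A - {e}))\<^sup>2"
        by (intro mult_right_mono power_mono exp_le) auto
      finally have "D e F A * (G A)\<^sup>2 \<le> D e F A * (9 * (G (A - {e}))\<^sup>2)"
        using D_nonneg[OF e A] by (intro mult_left_mono) auto
      moreover have "D e F (A - {e}) = D e F A" by (simp add: D_def)
      ultimately show "D e F A * (G A)\<^sup>2 \<le> 9 * (D e F (A - {e}) * (G (A - {e}))\<^sup>2)" by simp
    qed simp
    then have "(\<Sum>e\<in>S. E S (\<lambda>A. D e F A * (G A)\<^sup>2))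
        \<le> (\<Sum>e\<in>S. 9 / (1 - p) * E S (\<lambda>A. if e \<in> A then 0 else D e F A * (G A)\<^sup>2))"
      by (rule sum_mono)
    also have "\<dots> = 9 / (1 - p) * E S (\<lambda>A. \<Sum>e\<in>S. if e \<in> A then 0 else D e F A * (G A)\<^sup>2)"
      by (simp add: E_sum sum_distrib_left)
    also have "\<dots> \<le> 9 / (1 - p) * E S (\<lambda>A. N * (G A)\<^sup>2)"
    proof (intro mult_left_mono E_mono)
      fix A assume A: "A \<subseteq> S"
      have "(\<Sum>e\<in>S. if e \<in> A then 0 else D e F A * (G A)\<^sup>2) = (\<Sum>e\<in>S - A. D e F A * (G A)\<^sup>2)"
        by (rule sum.mono_neutral_cong_right) (use fin in auto)
      also have "\<dots> = (\<Sum>e\<in>S - A. D e F A) * (G A)\<^sup>2" by (simp add: sum_distrib_right)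
      also have "\<dots> \<le> N * (G A)\<^sup>2" using total[OF A] by (intro mult_right_mono) auto
      finally show "(\<Sum>e\<in>S. if e \<in> A then 0 else D e F A * (G A)\<^sup>2) \<le> N * (G A)\<^sup>2" .
    qed (use p_less_1 in auto)
    finally show ?thesis by (simp add: E_cmult Q_def)
  qed
  have en: "energy S G \<le> 9 * s\<^sup>2 * c * (9 * N / (1 - p) * Q)"
  proof -
    have "energy S G \<le> (\<Sum>e\<in>S. E S (\<lambda>A. 9 * s\<^sup>2 * c * (D e F A * (G A)\<^sup>2)))"
      unfolding energy_def
    proof (intro sum_mono E_mono)
      fix e A assume e: "e \<in> S" and A: "A \<subseteq> S"
      have "\<bar>D e G A\<bar>\<^sup>2 \<le> (3 * \<bar>s\<bar> * (D e F A * G A))\<^sup>2"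
        using DG[OF e A] by (intro power_mono) auto
      also have "\<dots> = 9 * s\<^sup>2 * D e F A * (D e F A * (G A)\<^sup>2)"
        by (simp add: power2_eq_square algebra_simps)
      also have "\<dots> \<le> 9 * s\<^sup>2 * c * (D e F A * (G A)\<^sup>2)"
        using D_le[OF e A] D_nonneg[OF e A] by (intro mult_right_mono mult_left_mono) auto
      finally show "(D e G A)\<^sup>2 \<le> 9 * s\<^sup>2 * c * (D e F A * (G A)\<^sup>2)" by simp
    qed
    also have "\<dots> = 9 * s\<^sup>2 * c * (\<Sum>e\<in>S. E S (\<lambda>A. D e F A * (G A)\<^sup>2))"
      unfolding E_cmult by (simp add: sum_distrib_left)
    also have "\<dots> \<le> 9 * s\<^sup>2 * c * (9 * N / (1 - p) * Q)"
      using nonneg by (intro mult_left_mono sum_DF) auto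
    finally show ?thesis .
  qed
  have l1: "(\<Sum>e\<in>S. (E S (\<lambda>A. \<bar>D e G A\<bar>))\<^sup>2) \<le> 9 * s\<^sup>2 * \<delta> * (9 * N / (1 - p) * Q)"
  proof -
    have "(\<Sum>e\<in>S. (E S (\<lambda>A. \<bar>D e G A\<bar>))\<^sup>2)
        \<le> (\<Sum>e\<in>S. 9 * s\<^sup>2 * \<delta> * E S (\<lambda>A. D e F A * (G A)\<^sup>2))"
    proof (rule sum_mono)
      fix e assume e: "e \<in> S"
      have "E S (\<lambda>A. \<bar>D e G A\<bar>) \<le> 3 * \<bar>s\<bar> * E S (\<lambda>A. D e F A * 1 * G A)"
        unfolding E_cmult[symmetric] using DG[OF e] by (intro E_mono) simp
      then have "(E S (\<lambda>A. \<bar>D e G A\<bar>))\<^sup>2 \<le> (3 * \<bar>s\<bar> * E S (\<lambda>A. D e F A * 1 * G A))\<^sup>2"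
        by (intro power_mono E_nonneg) auto
      also have "\<dots> = 9 * s\<^sup>2 * (E S (\<lambda>A. D e F A * 1 * G A))\<^sup>2"
        by (simp add: power_mult_distrib)
      also have "\<dots> \<le> 9 * s\<^sup>2 * (E S (\<lambda>A. D e F A * 1\<^sup>2) * E S (\<lambda>A. D e F A * (G A)\<^sup>2))"
        using D_nonneg[OF e] by (intro mult_left_mono E_Cauchy_Schwarz) auto
      also have "\<dots> \<le> 9 * s\<^sup>2 * (\<delta> * E S (\<lambda>A. D e F A * (G A)\<^sup>2))"
        using influence[OF e] D_nonneg[OF e]
        by (intro mult_left_mono mult_right_mono E_nonneg) auto
      finally show "(E S (\<lambda>A. \<bar>D e G A\<bar>))\<^sup>2 \<le> 9 * s\<^sup>2 * \<delta> * E S (\<lambda>A. D e F A * (G A)\<^sup>2)"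
        by (simp add: mult.assoc)
    qed
    also have "\<dots> = 9 * s\<^sup>2 * \<delta> * (\<Sum>e\<in>S. E S (\<lambda>A. D e F A * (G A)\<^sup>2))"
      by (simp add: sum_distrib_left)
    also have "\<dots> \<le> 9 * s\<^sup>2 * \<delta> * (9 * N / (1 - p) * Q)"
      using nonneg by (intro mult_left_mono sum_DF) auto
    finally show ?thesis .
  qed
  have "L * Var S G \<le> 2 * energy S G + exp L * (\<Sum>e\<in>S. (E S (\<lambda>A. \<bar>D e G A\<bar>))\<^sup>2)"
    by (rule modified_Poincare[OF fin])
  also have "\<dots> \<le> 2 * (9 * s\<^sup>2 * c * (9 * N / (1 - p) * Q))
      + exp L * (9 * s\<^sup>2 * \<delta> * (9 * N / (1 - p) * Q))"
    using en l1 by (intro add_mono mult_left_mono) auto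
  also have "\<dots> = 81 * N / (1 - p) * (2 * c + exp L * \<delta>) * s\<^sup>2 * Q"
    by (simp add: algebra_simps add_divide_distrib)
  finally show ?thesis unfolding Q_def G2 by (simp add: G_def)
qed

text \<open>
  Let \<open>M s\<close> be the exponential moment. The variance bound at \<open>s / 2\<close> says that \<open>M s\<close> exceeds
  \<open>(M (s / 2))\<^sup>2\<close> at most by the factor \<open>1 / (1 - \<kappa> * (s / 2)\<^sup>2)\<close>. Starting the iteration at the
  scale \<open>s / 2 ^ j\<close>, so small that the crude bound \<open>M s \<le> exp (R\<^sup>2 * s\<^sup>2)\<close> for a centred variable
  bounded by \<open>R\<close> is available, the contribution of \<open>R\<close> is halved in each step and disappears in the limit.
\<close>
theorem exp_moment_bound:
  assumes fin: "finite S" and mean: "E S X = 0" and \<kappa>: "0 \<le> \<kappa>"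
    and var: "\<And>s. \<bar>s\<bar> \<le> s0 \<Longrightarrow>
      Var S (\<lambda>A. exp (s * X A)) \<le> \<kappa> * s\<^sup>2 * E S (\<lambda>A. exp (2 * s * X A))"
    and s: "\<bar>s\<bar> \<le> s0" "\<kappa> * s\<^sup>2 \<le> 2"
  shows "E S (\<lambda>A. exp (s * X A)) \<le> exp (\<kappa> * s\<^sup>2)"
proof -
  define M where "M = (\<lambda>s. E S (\<lambda>A. exp (s * X A)))"
  define R where "R = (\<Sum>A\<in>Pow S. \<bar>X A\<bar>)"
  have R: "\<bar>X A\<bar> \<le> R" if "A \<subseteq> S" for A
    unfolding R_def using that fin by (intro member_le_sum) auto
  have R0: "0 \<le> R" unfolding R_def by (intro sum_nonneg) auto
  have halving: "M s \<le> (M (s / 2))\<^sup>2 * exp (\<kappa> * s\<^sup>2 / 2)" if "\<bar>s\<bar> \<le> s0" "\<kappa> * s\<^sup>2 \<le> 2" for s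
  proof -
    define x where "x = \<kappa> * (s / 2)\<^sup>2"
    have x: "0 \<le> x" "x \<le> 1 / 2" using that \<kappa> by (auto simp: x_def power2_eq_square)
    have "\<bar>s / 2\<bar> \<le> s0" using that by simp
    from var[OF this] have "M s - (M (s / 2))\<^sup>2 \<le> x * M s"
      by (simp add: Var_def M_def x_def exp_double[symmetric] mult.assoc)
    then have 1: "(1 - x) * M s \<le> (M (s / 2))\<^sup>2" by (simp add: algebra_simps)
    have "0 \<le> x * (1 - 2 * x)" using x by (intro mult_nonneg_nonneg) auto
    then have "1 \<le> (1 - x) * (1 + 2 * x)" by (simp add: algebra_simps)
    also have "\<dots> \<le> (1 - x) * exp (2 * x)"
      using x by (intro mult_left_mono exp_ge_add_one_self) auto
    finally have "1 * M s \<le> ((1 - x) * exp (2 * x)) * M s"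
      by (intro mult_right_mono) (auto simp: M_def intro: E_nonneg)
    also have "\<dots> = ((1 - x) * M s) * exp (2 * x)" by simp
    also have "\<dots> \<le> (M (s / 2))\<^sup>2 * exp (2 * x)" using 1 by (intro mult_right_mono) auto
    finally show ?thesis by (simp add: x_def power2_eq_square)
  qed
  have M0: "0 \<le> M s" for s unfolding M_def by (auto intro: E_nonneg)
  have *: "M s \<le> exp ((\<kappa> + R\<^sup>2 / 2 ^ j) * s\<^sup>2)"
    if "\<bar>s\<bar> * R \<le> 2 ^ j" "\<bar>s\<bar> \<le> s0" "\<kappa> * s\<^sup>2 \<le> 2" for j s
    using that
  proof (induction j arbitrary: s)
    case 0
    have "M s \<le> E S (\<lambda>A. 1 + s * X A + R\<^sup>2 * s\<^sup>2)"
      unfolding M_def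
    proof (rule E_mono)
      fix A assume A: "A \<subseteq> S"
      have "\<bar>s * X A\<bar> \<le> \<bar>s\<bar> * R" unfolding abs_mult using R[OF A] by (intro mult_left_mono) auto
      then have 1: "\<bar>s * X A\<bar> \<le> 1" using 0 by simp
      have "(s * X A)\<^sup>2 \<le> R\<^sup>2 * s\<^sup>2"
        unfolding power_mult_distrib using R[OF A] R0
        by (metis abs_ge_zero mult.commute mult_right_mono power2_abs power_mono zero_le_power2)
      then show "exp (s * X A) \<le> 1 + s * X A + R\<^sup>2 * s\<^sup>2"
        using exp_le_quadratic[OF 1] by linarith
    qed
    also have "\<dots> = 1 + R\<^sup>2 * s\<^sup>2"
      unfolding E_add E_cmult mean using fin by (simp add: E_const)
    also have "\<dots> \<le> exp (R\<^sup>2 * s\<^sup>2)" by (rule exp_ge_add_one_self)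
    also have "\<dots> \<le> exp ((\<kappa> + R\<^sup>2 / 2 ^ 0) * s\<^sup>2)" using \<kappa> by (simp add: mult_right_mono)
    finally show ?case .
  next
    case (Suc j)
    have "(s / 2)\<^sup>2 \<le> s\<^sup>2" by (simp add: power2_eq_square)
    then have "\<kappa> * (s / 2)\<^sup>2 \<le> \<kappa> * s\<^sup>2" using \<kappa> by (rule mult_left_mono)
    then have "M (s / 2) \<le> exp ((\<kappa> + R\<^sup>2 / 2 ^ j) * (s / 2)\<^sup>2)"
      using Suc.prems by (intro Suc.IH) auto
    then have "(M (s / 2))\<^sup>2 \<le> (exp ((\<kappa> + R\<^sup>2 / 2 ^ j) * (s / 2)\<^sup>2))\<^sup>2"
      using M0 by (rule power_mono)
    then have "M s \<le> (exp ((\<kappa> + R\<^sup>2 / 2 ^ j) * (s / 2)\<^sup>2))\<^sup>2 * exp (\<kappa> * s\<^sup>2 / 2)"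
      by (intro order_trans[OF halving[OF Suc.prems(2,3)]] mult_right_mono) auto
    also have "\<dots> = exp ((\<kappa> + R\<^sup>2 / 2 ^ Suc j) * s\<^sup>2)"
      unfolding exp_double[symmetric] exp_add[symmetric]
      by (simp add: field_simps power2_eq_square)
    finally show ?case .
  qed
  have "(\<lambda>j. exp ((\<kappa> + R\<^sup>2 * (1 / 2) ^ j) * s\<^sup>2)) \<longlonglongrightarrow> exp ((\<kappa> + R\<^sup>2 * 0) * s\<^sup>2)"
    by (intro tendsto_intros LIMSEQ_power_zero) auto
  moreover have "\<exists>j0. \<forall>j\<ge>j0. M s \<le> exp ((\<kappa> + R\<^sup>2 * (1 / 2) ^ j) * s\<^sup>2)"
  proof -
    obtain j0 where j0: "\<bar>s\<bar> * R < 2 ^ j0" using real_arch_pow[of 2 "\<bar>s\<bar> * R"] by auto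
    have "M s \<le> exp ((\<kappa> + R\<^sup>2 * (1 / 2) ^ j) * s\<^sup>2)" if "j0 \<le> j" for j
    proof -
      have "(2::real) ^ j0 \<le> 2 ^ j" using that by (intro power_increasing) auto
      then have "\<bar>s\<bar> * R \<le> 2 ^ j" using j0 by linarith
      then show ?thesis using *[of s j] s by (simp add: power_divide)
    qed
    then show ?thesis by blast
  qed
  ultimately have "M s \<le> exp ((\<kappa> + R\<^sup>2 * 0) * s\<^sup>2)" by (rule LIMSEQ_le_const)
  then show ?thesis by (simp add: M_def)
qed

lemma Chernoff_bound:
  assumes "finite S" "0 < s"
  shows "E S (\<lambda>A. of_bool (r < \<bar>X A\<bar>))
    \<le> exp (- (s * r)) * (E S (\<lambda>A. exp (s * X A)) + E S (\<lambda>A. exp (- s * X A)))"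
proof -
  have "E S (\<lambda>A. of_bool (r < \<bar>X A\<bar>))
      \<le> E S (\<lambda>A. exp (- (s * r)) * (exp (s * X A) + exp (- s * X A)))"
  proof (rule E_mono)
    fix A
    have "1 \<le> exp (- (s * r)) * (exp (s * X A) + exp (- s * X A))" if "r < \<bar>X A\<bar>"
    proof -
      have "s * r \<le> s * \<bar>X A\<bar>" using that assms by (intro mult_left_mono) auto
      then have "1 \<le> exp (- (s * r)) * exp (s * \<bar>X A\<bar>)" by (simp add: exp_add[symmetric])
      also have "\<dots> \<le> exp (- (s * r)) * (exp (s * X A) + exp (- s * X A))"
        by (intro mult_left_mono) (auto simp: abs_if)
      finally show ?thesis .
    qed
    then show "of_bool (r < \<bar>X A\<bar>) \<le> exp (- (s * r)) * (exp (s * X A) + exp (- s * X A))"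
      by (auto intro!: mult_nonneg_nonneg add_nonneg_nonneg)
  qed
  then show ?thesis by (simp add: E_cmult E_add)
qed

end

section \<open>The norm and paths of the lattice\<close>

lemma l1_norm_zero [simp]: "l1_norm 0 = 0"
  by (simp add: l1_norm_def)

lemma l1_norm_minus_commute: "l1_norm (u - v) = l1_norm (v - u)"
  by (simp add: l1_norm_def abs_minus_commute)

lemma l1_norm_triangle: "l1_norm (u + v) \<le> l1_norm u + l1_norm v"
  unfolding l1_norm_def sum.distrib[symmetric] by (intro sum_mono) simp

lemma lattice_edge_iff: "{u, w} \<in> lattice_edges \<longleftrightarrow> l1_norm (u - w) = 1"
  unfolding lattice_edges_def by (auto simp: doubleton_eq_iff l1_norm_minus_commute)

lemma finite_l1_ball: "finite {v :: int ^ 'd::finite. l1_norm (v - u) \<le> r}"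
proof -
  let ?F = "PiE UNIV (\<lambda>i. {u $ i - r .. u $ i + r})"
  have "{v. l1_norm (v - u) \<le> r} \<subseteq> vec_lambda ` ?F"
  proof
    fix v assume v: "v \<in> {v. l1_norm (v - u) \<le> r}"
    have "v $ i \<in> {u $ i - r .. u $ i + r}" for i
    proof -
      have "\<bar>(v - u) $ i\<bar> \<le> l1_norm (v - u)"
        unfolding l1_norm_def by (rule member_le_sum) auto
      then have "\<bar>v $ i - u $ i\<bar> \<le> r" using v by simp
      then show ?thesis unfolding atLeastAtMost_iff by linarith
    qed
    then have "vec_nth v \<in> ?F" by (intro PiE_I) auto
    then show "v \<in> vec_lambda ` ?F" by (rule image_eqI[rotated]) simp
  qed
  moreover have "finite ?F" by (intro finite_PiE) auto
  ultimately show ?thesis by (meson finite_imageI finite_subset)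
qed

lemma path_edges_append: "path_edges (xs @ y # ys) = path_edges (xs @ [y]) @ path_edges (y # ys)"
proof (induction xs)
  case (Cons x xs)
  then show ?case by (cases xs) auto
qed simp

lemma length_path_edges: "length (path_edges ws) = length ws - 1"
  by (induction ws rule: path_edges.induct) auto

lemma path_edges_map: "path_edges (map f ws) = map ((`) f) (path_edges ws)"
  by (induction ws rule: path_edges.induct) auto

lemma path_edge_subset_vertices: "e \<in> set (path_edges ws) \<Longrightarrow> e \<subseteq> set ws"
  by (induction ws rule: path_edges.induct) auto

lemma distinct_path_edges: "distinct ws \<Longrightarrow> distinct (path_edges ws)"
proof (induction ws rule: path_edges.induct)
  case (1 y z ws)
  then show ?case using path_edge_subset_vertices[of "{y, z}" "z # ws"] by auto
qed auto

lemma lattice_path_append: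
  "lattice_path u w (xs @ y # ys) \<longleftrightarrow> lattice_path u y (xs @ [y]) \<and> lattice_path y w (y # ys)"
  unfolding lattice_path_def by (auto simp: successively_append_iff hd_append successively_Cons)

lemma lattice_path_ends:
  assumes "lattice_path u w ws"
  shows "\<exists>xs. ws = u # xs" "\<exists>xs. ws = xs @ [w]"
proof -
  have "ws \<noteq> []" "hd ws = u" "last ws = w" using assms by (simp_all add: lattice_path_def)
  then have "u # tl ws = ws" "butlast ws @ [w] = ws"
    using hd_Cons_tl append_butlast_last_id by metis+
  then show "\<exists>xs. ws = u # xs" "\<exists>xs. ws = xs @ [w]" by metis+
qed

lemma lattice_path_exists_l1:
  "\<exists>ws. lattice_path (u :: int ^ 'd::finite) v ws \<and> int (length (path_edges ws)) = l1_norm (u - v)"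
proof (induction "nat (l1_norm (u - v))" arbitrary: u rule: less_induct)
  case less
  show ?case
  proof (cases "u = v")
    case True
    then have "lattice_path u v [u] \<and> int (length (path_edges [u])) = l1_norm (u - v)"
      by (simp add: lattice_path_def)
    then show ?thesis ..
  next
    case False
    then obtain i where i: "u $ i \<noteq> v $ i" by (auto simp: vec_eq_iff)
    define s where "s = sgn (v $ i - u $ i)"
    define w where "w = u + axis i s"
    have s: "\<bar>s\<bar> = 1" "\<bar>u $ i + s - v $ i\<bar> = \<bar>u $ i - v $ i\<bar> - 1"
      using i unfolding s_def by (auto simp: sgn_if)
    have split: "l1_norm z = \<bar>z $ i\<bar> + (\<Sum>j\<in>UNIV - {i}. \<bar>z $ j\<bar>)" for z :: "int ^ 'd"
      unfolding l1_norm_def by (simp add: sum.remove[of UNIV i])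
    have "l1_norm (u - w) = 1"
      unfolding split using s(1) by (simp add: w_def axis_def)
    then have e: "{u, w} \<in> lattice_edges" by (simp add: lattice_edge_iff)
    have wv: "l1_norm (w - v) = l1_norm (u - v) - 1"
      unfolding split using s(2) by (simp add: w_def axis_def)
    moreover have "0 < l1_norm (u - v)"
      unfolding split using i by (intro add_pos_nonneg sum_nonneg) auto
    ultimately have "nat (l1_norm (w - v)) < nat (l1_norm (u - v))" by simp
    from less[OF this] obtain ws
      where ws: "lattice_path w v ws" "int (length (path_edges ws)) = l1_norm (w - v)" by blast
    obtain xs where xs: "ws = w # xs" using ws(1) unfolding lattice_path_def by (cases ws) auto
    have "lattice_path u v (u # ws)"
      using e ws(1) unfolding lattice_path_def xs by (auto simp: successively_Cons)
    moreover have "int (length (path_edges (u # ws))) = l1_norm (u - v)"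
      using ws(2) wv xs by simp
    ultimately show ?thesis by blast
  qed
qed

lemma lattice_path_vertex_distance:
  assumes "lattice_path u w ws" "y \<in> set ws"
  shows "l1_norm (y - u) \<le> int (length (path_edges ws))"
  using assms
proof (induction ws arbitrary: u rule: path_edges.induct)
  case (1 x z ws)
  then have x: "x = u" and e: "l1_norm (z - u) = 1" and p: "lattice_path z w (z # ws)"
    by (auto simp: lattice_path_def lattice_edge_iff l1_norm_minus_commute)
  show ?case
  proof (cases "y = x")
    case False
    then have "y \<in> set (z # ws)" using 1 by auto
    from 1(1)[OF p this] have "l1_norm (y - z) \<le> int (length (path_edges (z # ws)))" .
    moreover have "l1_norm (y - u) \<le> l1_norm (y - z) + l1_norm (z - u)"
      using l1_norm_triangle[of "y - z" "z - u"] by simp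
    ultimately show ?thesis using e by simp
  qed (simp add: x)
qed (auto simp: lattice_path_def)

lemma l1_norm_axis: "l1_norm (axis i s) = \<bar>s\<bar>"
proof -
  have "l1_norm (axis i s) = (\<Sum>j\<in>UNIV. if j = i then \<bar>s\<bar> else 0)"
    unfolding l1_norm_def by (intro sum.cong) (auto simp: axis_def)
  then show ?thesis by simp
qed

text \<open>
  A box in two coordinate directions suffices in every dimension at least two: it has of order \<open>m\<^sup>2\<close>
  points, while a geodesic has only of order \<open>m\<close> vertices in it.
\<close>
lemma planar_box:
  assumes "CARD('d::finite) \<ge> 2"
  shows "\<exists>Z :: (int ^ 'd) set. finite Z \<and> card Z = m * m \<and> (\<forall>z\<in>Z. l1_norm z \<le> 2 * int m)
    \<and> (0 < m \<longrightarrow> 0 \<in> Z)"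
proof -
  have "\<exists>i j :: 'd. i \<noteq> j"
  proof (rule ccontr)
    assume "\<not> ?thesis"
    then have "(UNIV :: 'd set) \<subseteq> {undefined}" by auto
    then have "CARD('d) \<le> card {undefined :: 'd}" by (rule card_mono[rotated]) simp
    then show False using assms by simp
  qed
  then obtain i j :: 'd where ij: "i \<noteq> j" by blast
  define \<phi> :: "nat \<times> nat \<Rightarrow> int ^ 'd" where "\<phi> = (\<lambda>(s, t). axis i (int s) + axis j (int t))"
  define Z where "Z = \<phi> ` ({..<m} \<times> {..<m})"
  have comp: "\<phi> (s, t) $ i = int s" "\<phi> (s, t) $ j = int t" for s t
    using ij by (auto simp: \<phi>_def axis_def)
  have "inj \<phi>"
  proof (rule injI)
    fix x y assume "\<phi> x = \<phi> y"
    then show "x = y" using comp by (metis of_nat_eq_iff prod.collapse)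
  qed
  then have "card Z = card ({..<m} \<times> {..<m})"
    unfolding Z_def by (intro card_image) (auto intro: inj_on_subset)
  moreover have "l1_norm z \<le> 2 * int m" if "z \<in> Z" for z
  proof -
    obtain s t where st: "s < m" "t < m" "z = axis i (int s) + axis j (int t)"
      using \<open>z \<in> Z\<close> by (auto simp: Z_def \<phi>_def)
    have "l1_norm z \<le> l1_norm (axis i (int s) :: int ^ 'd) + l1_norm (axis j (int t) :: int ^ 'd)"
      unfolding st(3) by (rule l1_norm_triangle)
    then show ?thesis using st by (simp add: l1_norm_axis)
  qed
  moreover have "0 \<in> Z" if "0 < m"
  proof -
    have "\<phi> (0, 0) = 0" by (simp add: \<phi>_def axis_def vec_eq_iff)
    then show ?thesis unfolding Z_def using that by (intro image_eqI[of _ _ "(0, 0)"]) auto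
  qed
  moreover have "finite Z" by (simp add: Z_def)
  ultimately show ?thesis by (intro exI[of _ Z]) (simp add: card_cartesian_product)
qed

section \<open>Geodesics for weights with two values\<close>

text \<open>
  A configuration of weights in \<open>{a, b}\<close> is encoded by the set \<open>A\<close> of the edges of weight \<open>b\<close>.
\<close>
locale two_weights =
  fixes a b :: real
  assumes a_pos: "0 < a" and a_less_b: "a < b"
begin

definition weight :: "'v set set \<Rightarrow> 'v set \<Rightarrow> real" where
  "weight A e = (if e \<in> A then b else a)"

definition cost :: "'v set set \<Rightarrow> 'v list \<Rightarrow> real" where
  "cost A ws = sum_list (map (weight A) (path_edges ws))"

definition T :: "int ^ 'd::finite \<Rightarrow> int ^ 'd \<Rightarrow> (int ^ 'd) set set \<Rightarrow> real" where
  "T u w A = first_passage_time (weight A) u w"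

definition geodesic ::
    "int ^ 'd::finite \<Rightarrow> int ^ 'd \<Rightarrow> (int ^ 'd) set set \<Rightarrow> (int ^ 'd) list \<Rightarrow> bool" where
  "geodesic u w A ws \<longleftrightarrow> lattice_path u w ws \<and> cost A ws = T u w A"

lemma weight_bounds: "a \<le> weight A e" "weight A e \<le> b"
  using a_less_b by (auto simp: weight_def)

lemma cost_append: "cost A (xs @ y # ys) = cost A (xs @ [y]) + cost A (y # ys)"
  unfolding cost_def by (subst path_edges_append) simp

lemma cost_ge: "a * real (length (path_edges ws)) \<le> cost A ws"
  using sum_list_mono[of "path_edges ws" "\<lambda>_. a" "weight A", OF weight_bounds(1)]
  by (simp add: cost_def sum_list_triv mult.commute)

lemma cost_le: "cost A ws \<le> b * real (length (path_edges ws))"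
  using sum_list_mono[of "path_edges ws" "weight A" "\<lambda>_. b", OF weight_bounds(2)]
  by (simp add: cost_def sum_list_triv mult.commute)

lemma cost_nonneg: "0 \<le> cost A ws"
  using cost_ge[of ws A] a_pos by (meson mult_nonneg_nonneg of_nat_0_le_iff order_trans less_imp_le)

lemma T_eq_Inf: "T u w A = Inf (cost A ` {ws. lattice_path u w ws})"
  by (simp add: T_def first_passage_time_def cost_def)

lemma T_le_cost:
  assumes "lattice_path u w ws"
  shows "T u w A \<le> cost A ws"
  unfolding T_eq_Inf using assms cost_nonneg
  by (intro cINF_lower bdd_belowI2[where m=0]) auto

lemma weight_sum_form:
  "\<exists>i j. i + j = length es \<and> sum_list (map (weight A) es) = a * real i + b * real j"
proof (induction es)
  case (Cons e es)
  then obtain i j where ij: "i + j = length es" "sum_list (map (weight A) es) = a * real i + b * real j"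
    by blast
  show ?case
  proof (cases "e \<in> A")
    case True
    then have "weight A e = b" by (simp add: weight_def)
    then have "i + Suc j = length (e # es) \<and>
        sum_list (map (weight A) (e # es)) = a * real i + b * real (Suc j)"
      using ij by (simp add: algebra_simps)
    then show ?thesis by blast
  next
    case False
    then have "weight A e = a" by (simp add: weight_def)
    then have "Suc i + j = length (e # es) \<and>
        sum_list (map (weight A) (e # es)) = a * real (Suc i) + b * real j"
      using ij by (simp add: algebra_simps)
    then show ?thesis by blast
  qed
qed simp

text \<open>
  The infimum is attained: costs have the form \<open>a * i + b * j\<close> with natural numbers \<open>i\<close> and \<open>j\<close>, and
  since \<open>a\<close> is positive only finitely many of these numbers lie below a given cost.
\<close>
lemma geodesic_exists: "\<exists>ws. geodesic u w A ws"
proof -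
  define C where "C = cost A ` {ws. lattice_path u w ws}"
  obtain ws0 where ws0: "lattice_path u w ws0" using lattice_path_exists by blast
  define N where "N = nat \<lceil>cost A ws0 / a\<rceil>"
  have "{c \<in> C. c \<le> cost A ws0} \<subseteq> (\<lambda>(i, j). a * real i + b * real j) ` ({..N} \<times> {..N})"
  proof
    fix c assume "c \<in> {c \<in> C. c \<le> cost A ws0}"
    then obtain ws where ws: "c = cost A ws" "cost A ws \<le> cost A ws0" by (auto simp: C_def)
    obtain i j where ij: "i + j = length (path_edges ws)" "cost A ws = a * real i + b * real j"
      using weight_sum_form[of "path_edges ws" A] by (auto simp: cost_def)
    have "a * real (i + j) \<le> cost A ws0" using cost_ge[of ws A] ws ij by simp
    then have "real (i + j) \<le> cost A ws0 / a" using a_pos by (simp add: field_simps)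
    then have "i + j \<le> N" unfolding N_def by linarith
    then show "c \<in> (\<lambda>(i, j). a * real i + b * real j) ` ({..N} \<times> {..N})"
      using ws ij by (intro image_eqI[of _ _ "(i, j)"]) auto
  qed
  then have fin: "finite {c \<in> C. c \<le> cost A ws0}" by (rule finite_subset) simp
  have ne: "cost A ws0 \<in> {c \<in> C. c \<le> cost A ws0}" using ws0 by (auto simp: C_def)
  define m where "m = Min {c \<in> C. c \<le> cost A ws0}"
  have m: "m \<in> {c \<in> C. c \<le> cost A ws0}" unfolding m_def using fin ne by (intro Min_in) auto
  have "m \<le> c" if "c \<in> C" for c
  proof (cases "c \<le> cost A ws0")
    case True
    then show ?thesis unfolding m_def using fin that by (intro Min_le) auto
  next
    case False
    then show ?thesis using m by auto
  qed
  then have "Inf C = m" using m by (intro cInf_eq_minimum) auto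
  then show ?thesis using m unfolding geodesic_def T_eq_Inf C_def by auto
qed

lemma T_le_l1: "T u w A \<le> b * real_of_int (l1_norm (u - w))"
proof -
  obtain ws where ws: "lattice_path u w ws" "int (length (path_edges ws)) = l1_norm (u - w)"
    using lattice_path_exists_l1 by blast
  have "T u w A \<le> b * real (length (path_edges ws))"
    using T_le_cost[OF ws(1)] cost_le order_trans by blast
  then show ?thesis using ws(2) by (metis of_int_of_nat_eq)
qed

lemma geodesic_length:
  assumes "geodesic u w A ws"
  shows "a * real (length (path_edges ws)) \<le> b * real_of_int (l1_norm (u - w))"
  using assms cost_ge[of ws A] T_le_l1[of u w A] by (simp add: geodesic_def)

lemma T_triangle: "T u w A \<le> T u y A + T y w A"
proof -
  obtain ws1 ws2 where ws: "geodesic u y A ws1" "geodesic y w A ws2"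
    using geodesic_exists by meson
  have p: "lattice_path u y ws1" "lattice_path y w ws2"
    and c: "cost A ws1 = T u y A" "cost A ws2 = T y w A"
    using ws unfolding geodesic_def by blast+
  obtain xs where xs: "ws1 = xs @ [y]" using lattice_path_ends(2)[OF p(1)] ..
  obtain ys where ys: "ws2 = y # ys" using lattice_path_ends(1)[OF p(2)] ..
  note eq = xs ys
  have "lattice_path u w (xs @ y # ys)"
    using p unfolding eq by (rule iffD2[OF lattice_path_append, OF conjI])
  then have "T u w A \<le> cost A (xs @ y # ys)" by (rule T_le_cost)
  also have "\<dots> = cost A ws1 + cost A ws2" unfolding eq by (rule cost_append)
  finally show ?thesis unfolding c .
qed

text \<open>
  Cutting out a loop would save at least \<open>a\<close>. Consequently a geodesic uses each edge at most once.
\<close>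
lemma geodesic_distinct:
  assumes "geodesic u w A ws"
  shows "distinct ws"
proof (rule ccontr)
  assume "\<not> distinct ws"
  then obtain xs ys zs y where ws: "ws = xs @ [y] @ ys @ [y] @ zs"
    using not_distinct_decomp by blast
  have path: "lattice_path u w (xs @ y # ys @ y # zs)"
    using assms ws by (simp add: geodesic_def)
  then have p1: "lattice_path u y (xs @ [y])" and "lattice_path y w (y # ys @ y # zs)"
    unfolding lattice_path_append[of u w xs] by auto
  then have p2: "lattice_path y w (y # zs)"
    using lattice_path_append[of y w "y # ys" y zs] by simp
  have "T u w A \<le> cost A (xs @ y # zs)"
    by (intro T_le_cost iffD2[OF lattice_path_append, OF conjI[OF p1 p2]])
  moreover have "cost A ws = cost A (xs @ [y]) + (cost A (y # ys @ [y]) + cost A (y # zs))"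
    using cost_append[of A xs y "ys @ y # zs"] cost_append[of A "y # ys" y zs] ws by simp
  moreover have "0 < cost A (y # ys @ [y])"
  proof -
    have "0 < a * real (length (path_edges (y # ys @ [y])))"
      using a_pos by (simp add: length_path_edges)
    then show ?thesis using cost_ge[of "y # ys @ [y]" A] by linarith
  qed
  ultimately show False
    using assms cost_append[of A xs y zs] by (simp add: geodesic_def)
qed

text \<open>
  A segment of a geodesic costs at least \<open>a\<close> per edge and, by the triangle inequality, no more than
  the passage time between its ends.
\<close>
lemma geodesic_segment:
  assumes geo: "geodesic u w A ws" and ij: "i < j" "j < length ws"
  shows "a * real (j - i) \<le> b * real_of_int (l1_norm (ws ! i - ws ! j))"
proof -
  define xs y ys y' zs where "xs = take i ws" and "y = ws ! i"
    and "ys = take (j - Suc i) (drop (Suc i) ws)" and "y' = ws ! j"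
    and "zs = drop (Suc j) ws"
  have "ws = xs @ y # drop (Suc i) ws"
    unfolding xs_def y_def using ij by (intro id_take_nth_drop) simp
  moreover have "drop (Suc i) ws = ys @ y' # zs"
    unfolding ys_def y'_def zs_def using id_take_nth_drop[of "j - Suc i" "drop (Suc i) ws"] ij by simp
  ultimately have ws: "ws = xs @ y # ys @ y' # zs" by simp
  have len: "length (path_edges (y # ys @ [y'])) = j - i"
    using ij by (simp add: length_path_edges ys_def)
  have "lattice_path u w ws" using geo by (simp add: geodesic_def)
  then have p1: "lattice_path u y (xs @ [y])" and p3: "lattice_path y' w (y' # zs)"
    unfolding ws using lattice_path_append[of u w "xs @ y # ys" y' zs]
      lattice_path_append[of u w xs y "ys @ y' # zs"] by auto
  have c1: "T u y A \<le> cost A (xs @ [y])" and c3: "T y' w A \<le> cost A (y' # zs)"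
    using p1 p3 by (auto intro: T_le_cost)
  have "cost A ws = cost A (xs @ [y]) + (cost A (y # ys @ [y']) + cost A (y' # zs))"
    using cost_append[of A xs y "ys @ y' # zs"] cost_append[of A "y # ys" y' zs] ws by simp
  moreover have "cost A ws \<le> T u y A + (T y y' A + T y' w A)"
    using T_triangle[of u w A y] T_triangle[of y w A y'] geo by (simp add: geodesic_def)
  ultimately have "cost A (y # ys @ [y']) \<le> T y y' A" using c1 c3 by linarith
  also have "\<dots> \<le> b * real_of_int (l1_norm (y - y'))" by (rule T_le_l1)
  finally have "cost A (y # ys @ [y']) \<le> b * real_of_int (l1_norm (y - y'))" .
  moreover have "a * real (j - i) \<le> cost A (y # ys @ [y'])"
    using cost_ge[of "y # ys @ [y']" A] unfolding len .
  ultimately show ?thesis unfolding y_def y'_def by (rule order_trans[rotated])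
qed

text \<open>
  All visits to \<open>R\<close> occur between the first and the last one, and the segment between these two has
  at most \<open>b / a * r\<close> edges.
\<close>
lemma geodesic_vertices_card:
  assumes geo: "geodesic u w A ws"
    and diam: "\<And>y y'. y \<in> R \<Longrightarrow> y' \<in> R \<Longrightarrow> real_of_int (l1_norm (y - y')) \<le> r" and r: "0 \<le> r"
  shows "real (card (set ws \<inter> R)) \<le> b / a * r + 1"
proof (cases "set ws \<inter> R = {}")
  case True
  then have "real (card (set ws \<inter> R)) = 0" by simp
  moreover have "0 \<le> b / a * r" using r a_pos a_less_b by auto
  ultimately show ?thesis by linarith
next
  case False
  define I where "I = {i. i < length ws \<and> ws ! i \<in> R}"
  have fin: "finite I" by (simp add: I_def)
  have img: "set ws \<inter> R = (!) ws ` I"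
    unfolding I_def set_conv_nth by blast
  then have ne: "I \<noteq> {}" using False by auto
  define i j where "i = Min I" and "j = Max I"
  have i: "i \<in> I" and j: "j \<in> I" unfolding i_def j_def using fin ne by auto
  have "I \<subseteq> {i..j}" unfolding i_def j_def using fin by auto
  then have "card I \<le> Suc j - i" by (metis card_atLeastAtMost card_mono finite_atLeastAtMost)
  moreover have le: "i \<le> j" unfolding i_def using fin j by auto
  ultimately have 1: "real (card I) \<le> real (j - i) + 1" by linarith
  have "a * real (j - i) \<le> b * r"
  proof (cases "i = j")
    case True
    then show ?thesis using r a_pos a_less_b by simp
  next
    case False
    then have "a * real (j - i) \<le> b * real_of_int (l1_norm (ws ! i - ws ! j))"
      using le j by (intro geodesic_segment[OF geo]) (auto simp: I_def)
    also have "\<dots> \<le> b * r" using diam i j a_pos a_less_b by (intro mult_left_mono) (simp_all add: I_def)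
    finally show ?thesis .
  qed
  then have "real (j - i) \<le> b / a * r" using a_pos by (simp add: field_simps)
  then have "real (card I) \<le> b / a * r + 1" by (intro order_trans[OF 1] add_right_mono)
  moreover have "real (card (set ws \<inter> R)) \<le> real (card I)"
    unfolding img of_nat_le_iff by (rule card_image_le[OF fin])
  ultimately show ?thesis by (rule order_trans[rotated])
qed

lemma T_mono:
  assumes "A \<subseteq> B"
  shows "T u w A \<le> T u w B"
proof -
  obtain ws where ws: "geodesic u w B ws" using geodesic_exists by blast
  have "cost A ws \<le> cost B ws"
    unfolding cost_def using assms a_less_b by (intro sum_list_mono) (auto simp: weight_def)
  then show ?thesis using ws T_le_cost[of u w ws A] by (simp add: geodesic_def)
qed

text \<open>
  A geodesic for \<open>A\<close> is a competitor for the increased weights. Its cost changes only if it uses \<open>e\<close>,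
  and then by \<open>b - a\<close>, because it uses \<open>e\<close> once.
\<close>
lemma T_insert_le:
  assumes geo: "geodesic u w A ws" and e: "e \<notin> A"
  shows "T u w (insert e A) \<le> T u w A + (b - a) * of_bool (e \<in> set (path_edges ws))"
proof -
  have *: "sum_list (map (weight (insert e A)) es)
      = sum_list (map (weight A) es) + (b - a) * of_bool (e \<in> set es)" if "distinct es" for es
    using that e by (induction es) (auto simp: weight_def)
  have "T u w (insert e A) \<le> cost (insert e A) ws"
    using geo by (intro T_le_cost) (simp add: geodesic_def)
  also have "\<dots> = cost A ws + (b - a) * of_bool (e \<in> set (path_edges ws))"
    unfolding cost_def by (intro * distinct_path_edges geodesic_distinct[OF geo])
  finally show ?thesis using geo by (simp add: geodesic_def)
qed

text \<open>
  A finite set that contains every edge of every geodesic from \<open>u\<close> to \<open>w\<close>, whatever the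
  configuration. The condition is multiplied by \<open>a\<close> to avoid a division.
\<close>
definition reach :: "int ^ 'd::finite \<Rightarrow> int ^ 'd \<Rightarrow> (int ^ 'd) set set" where
  "reach u w = {e \<in> lattice_edges. \<forall>y\<in>e. a * real_of_int (l1_norm (y - u)) \<le> b * real_of_int (l1_norm (u - w))}"

lemma finite_reach: "finite (reach u w)"
proof -
  define r where "r = \<lfloor>b / a * real_of_int (l1_norm (u - w))\<rfloor>"
  have "reach u w \<subseteq> Pow {y. l1_norm (y - u) \<le> r}"
    unfolding reach_def r_def using a_pos by (auto simp: le_floor_iff field_simps)
  then show ?thesis by (rule finite_subset) (simp add: finite_l1_ball)
qed

lemma reach_subset: "reach u w \<subseteq> lattice_edges"
  by (auto simp: reach_def)

lemma geodesic_reach: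
  assumes "geodesic u w A ws"
  shows "set (path_edges ws) \<subseteq> reach u w"
proof
  fix e assume e: "e \<in> set (path_edges ws)"
  have path: "lattice_path u w ws" using assms by (simp add: geodesic_def)
  have "e \<in> lattice_edges"
    using e path path_edges_in_lattice_edges unfolding lattice_path_def by blast
  moreover have "a * real_of_int (l1_norm (y - u)) \<le> b * real_of_int (l1_norm (u - w))" if "y \<in> e" for y
  proof -
    have "y \<in> set ws" using path_edge_subset_vertices[OF e] that by blast
    from lattice_path_vertex_distance[OF path this]
    have "real_of_int (l1_norm (y - u)) \<le> real (length (path_edges ws))" by linarith
    then have "a * real_of_int (l1_norm (y - u)) \<le> a * real (length (path_edges ws))"
      using a_pos by (intro mult_left_mono) auto
    then show ?thesis using geodesic_length[OF assms] by linarith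
  qed
  ultimately show "e \<in> reach u w" by (simp add: reach_def)
qed

text \<open>
  A geodesic for one of the two configurations costs the same in the other one, since all its edges
  lie in \<open>reach u w\<close>.
\<close>
lemma T_reach: "T u w (A \<inter> reach u w) = T u w A"
proof (rule antisym)
  obtain ws where ws: "geodesic u w (A \<inter> reach u w) ws" using geodesic_exists by blast
  have "cost A ws = cost (A \<inter> reach u w) ws"
    unfolding cost_def using geodesic_reach[OF ws]
    by (intro arg_cong[of _ _ sum_list] map_cong) (auto simp: weight_def)
  then show "T u w A \<le> T u w (A \<inter> reach u w)"
    using ws T_le_cost[of u w ws A] by (simp add: geodesic_def)
qed (intro T_mono Int_lower1)

definition shift :: "int ^ 'd \<Rightarrow> (int ^ 'd) set \<Rightarrow> (int ^ 'd) set" where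
  "shift z e = (\<lambda>y. y + z) ` e"

lemma bij_shift: "bij (shift z)"
proof (rule bij_betw_byWitness[where f'="shift (- z)"])
qed (auto simp: shift_def image_image)

lemma lattice_path_translate:
  "lattice_path (u + z) (w + z) (map (\<lambda>y. y + z) ws) \<longleftrightarrow> lattice_path u w ws"
  unfolding lattice_path_def
  by (auto simp: hd_map last_map successively_map lattice_edge_iff)

lemma T_translate: "T (u + z) (w + z) A = T u w (shift z -` A)"
proof -
  have "{ws. lattice_path (u + z) (w + z) ws} = map (\<lambda>y. y + z) ` {ws. lattice_path u w ws}"
  proof (intro equalityI subsetI)
    fix ws assume ws: "ws \<in> {ws. lattice_path (u + z) (w + z) ws}"
    have "ws = map (\<lambda>y. y + z) (map (\<lambda>y. y - z) ws)" by (simp add: o_def)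
    moreover from this have "lattice_path u w (map (\<lambda>y. y - z) ws)"
      using ws lattice_path_translate by (metis mem_Collect_eq)
    ultimately show "ws \<in> map (\<lambda>y. y + z) ` {ws. lattice_path u w ws}" by blast
  qed (auto simp: lattice_path_translate)
  moreover have "cost A (map (\<lambda>y. y + z) ws) = cost (shift z -` A) ws" for ws
  proof -
    have "weight A (shift z e) = weight (shift z -` A) e" for e by (simp add: weight_def)
    moreover have "(`) (\<lambda>y. y + z) = shift z" by (rule ext) (simp add: shift_def)
    ultimately show ?thesis by (simp add: cost_def path_edges_map o_def)
  qed
  ultimately show ?thesis unfolding T_eq_Inf by (simp add: image_image)
qed

end

section \<open>From the product measure to the finite cube\<close>

context bernoulli_cube
begin

lemma AE_two_point:
  assumes "0 \<le> a" "0 \<le> b"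
  shows "AE y in two_point_measure a b p. y = a \<or> y = b"
proof (rule AE_I[where N="{0..} - {a, b}"])
  have *: "{0..} - {a, b} \<in> sets nonneg_borel"
    by (auto simp: sets_restrict_space_iff)
  then show "emeasure (two_point_measure a b p) ({0..} - {a, b}) = 0"
    by (simp add: emeasure_two_point_measure)
  show "{0..} - {a, b} \<in> sets (two_point_measure a b p)"
    using * by (simp add: sets_two_point_measure)
qed (auto simp: space_two_point_measure)

text \<open>
  That the edges of \<open>S\<close> with weight \<open>b\<close> are exactly those of \<open>A\<close> is a cylinder event: the weight
  of each edge of \<open>S\<close> is restricted either to \<open>{b}\<close> or to the complement of \<open>{b}\<close>.
\<close>
lemma measure_configuration:
  fixes S :: "(int ^ 'd::finite) set set"
  assumes ab: "0 \<le> a" "a < b" and S: "finite S" "S \<subseteq> lattice_edges" and A: "A \<subseteq> S"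
  defines "M \<equiv> edge_measure a b p :: ((int ^ 'd) set \<Rightarrow> real) measure"
  shows "{x \<in> space M. {e \<in> S. x e = b} = A} \<in> sets M"
    and "measure M {x \<in> space M. {e \<in> S. x e = b} = A} = p ^ card A * (1 - p) ^ card (S - A)"
proof -
  have pr: "prob_space (two_point_measure a b p)"
    using ab p_pos p_less_1 by (intro prob_space_two_point_measure) auto
  interpret product_prob_space "\<lambda>_. two_point_measure a b p" "lattice_edges :: (int ^ 'd) set set"
    using pr by (simp add: product_prob_space_def product_prob_space_axioms_def
      product_sigma_finite_def prob_space_imp_sigma_finite)
  \<comment> \<open>The state space of an edge is the set of all nonnegative reals, not just \<open>{a, b}\<close>.\<close>
  define X where "X = (\<lambda>e. if e \<in> A then {b} else {0..} - {b})"
  have X: "X e \<in> sets nonneg_borel" for e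
    using ab by (auto simp: X_def sets_restrict_space_iff)
  have eq: "{x \<in> space M. {e \<in> S. x e = b} = A} =
      prod_emb lattice_edges (\<lambda>_. two_point_measure a b p) S (PiE S X)"
  proof (intro equalityI subsetI)
    fix x assume x: "x \<in> {x \<in> space M. {e \<in> S. x e = b} = A}"
    then have sp: "x \<in> extensional lattice_edges" "\<forall>e\<in>lattice_edges. 0 \<le> x e"
      by (auto simp: M_def edge_measure_def space_PiM space_two_point_measure PiE_iff)
    have "\<forall>e\<in>S. x e \<in> X e" using x sp(2) S(2) by (auto simp: X_def)
    then show "x \<in> prod_emb lattice_edges (\<lambda>_. two_point_measure a b p) S (PiE S X)"
      using sp by (simp add: prod_emb_iff restrict_PiE_iff space_two_point_measure)
  next
    fix x assume "x \<in> prod_emb lattice_edges (\<lambda>_. two_point_measure a b p) S (PiE S X)"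
    then have sp: "x \<in> space M" and x: "\<forall>e\<in>S. x e \<in> X e"
      by (auto simp: prod_emb_iff restrict_PiE_iff M_def edge_measure_def space_PiM PiE_iff)
    have "x e = b \<longleftrightarrow> e \<in> A" if "e \<in> S" for e using x that by (auto simp: X_def split: if_splits)
    then have "{e \<in> S. x e = b} = A" using A by blast
    with sp show "x \<in> {x \<in> space M. {e \<in> S. x e = b} = A}" by simp
  qed
  show "{x \<in> space M. {e \<in> S. x e = b} = A} \<in> sets M"
    unfolding eq unfolding M_def edge_measure_def using S X
    by (intro sets_PiM_I) (auto simp: sets_two_point_measure)
  have "emeasure (two_point_measure a b p) (X e) = ennreal (if e \<in> A then p else 1 - p)" for e
    using X[of e] ab by (simp add: emeasure_two_point_measure X_def)
  then have m: "measure (two_point_measure a b p) (X e) = (if e \<in> A then p else 1 - p)" for e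
    using p_pos p_less_1 by (simp add: measure_def)
  have "measure M {x \<in> space M. {e \<in> S. x e = b} = A}
      = (\<Prod>e\<in>S. measure (two_point_measure a b p) (X e))"
    unfolding eq unfolding M_def edge_measure_def using S X
    by (intro measure_PiM_emb) (auto simp: sets_two_point_measure)
  also have "\<dots> = (\<Prod>e\<in>S. if e \<in> A then p else 1 - p)" by (simp add: m)
  also have "\<dots> = p ^ card A * (1 - p) ^ card (S - A)"
  proof -
    have "S \<inter> A = A" using A by auto
    then show ?thesis using S(1) by (simp add: prod.If_cases Diff_eq)
  qed
  finally show "measure M {x \<in> space M. {e \<in> S. x e = b} = A} = p ^ card A * (1 - p) ^ card (S - A)" .
qed

text \<open>
  A function of the configuration on a finite set is a finite combination of indicators of
  cylinders.
\<close>
theorem integral_configuration: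
  fixes S :: "(int ^ 'd::finite) set set"
  assumes ab: "0 \<le> a" "a < b" and S: "finite S" "S \<subseteq> lattice_edges"
  defines "M \<equiv> edge_measure a b p :: ((int ^ 'd) set \<Rightarrow> real) measure"
  shows "(\<integral>x. h {e \<in> S. x e = b} \<partial>M) = E S h"
    and "(\<lambda>x. h {e \<in> S. x e = b}) \<in> borel_measurable M"
proof -
  interpret prob_space M
    unfolding M_def using ab p_pos p_less_1 by (intro prob_space_edge_measure) auto
  let ?C = "\<lambda>A. {x \<in> space M. {e \<in> S. x e = b} = A}"
  have meas: "?C A \<in> sets M" if "A \<in> Pow S" for A
    using measure_configuration(1)[OF ab S, of A] that by (simp add: M_def)
  have eq: "h {e \<in> S. x e = b} = (\<Sum>A\<in>Pow S. h A * indicator (?C A) x)" if "x \<in> space M" for x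
  proof -
    have "(\<Sum>A\<in>Pow S. h A * indicator (?C A) x) = (\<Sum>A\<in>Pow S. if {e \<in> S. x e = b} = A then h A else 0)"
      using that by (intro sum.cong) (auto simp: indicator_def)
    also have "\<dots> = h {e \<in> S. x e = b}" using S(1) by (simp add: sum.delta')
    finally show ?thesis by simp
  qed
  have "(\<integral>x. h {e \<in> S. x e = b} \<partial>M) = (\<integral>x. (\<Sum>A\<in>Pow S. h A * indicator (?C A) x) \<partial>M)"
    by (intro Bochner_Integration.integral_cong refl eq)
  also have "\<dots> = (\<Sum>A\<in>Pow S. \<integral>x. h A * indicator (?C A) x \<partial>M)"
    using meas by (intro Bochner_Integration.integral_sum integrable_mult_right)
      (auto simp: integrable_indicator_iff less_top[symmetric])
  also have "\<dots> = (\<Sum>A\<in>Pow S. h A * measure M (?C A))"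
    using meas by (intro sum.cong refl) simp
  also have "\<dots> = E S h"
    unfolding E_def M_def using measure_configuration(2)[OF ab S] by (intro sum.cong refl) auto
  finally show "(\<integral>x. h {e \<in> S. x e = b} \<partial>M) = E S h" .
  have "(\<lambda>x. \<Sum>A\<in>Pow S. h A * indicator (?C A) x) \<in> borel_measurable M"
    using meas by (intro borel_measurable_sum borel_measurable_times borel_measurable_indicator) auto
  then show "(\<lambda>x. h {e \<in> S. x e = b}) \<in> borel_measurable M"
    by (rule measurable_cong[THEN iffD2, rotated]) (rule eq)
qed

lemma AE_edge_weight:
  assumes ab: "0 \<le> a" "a < b"
  shows "AE x in edge_measure a b p. \<forall>e\<in>(lattice_edges :: (int ^ 'd::finite) set set). x e = a \<or> x e = b"
proof -
  have "countable (lattice_edges :: (int ^ 'd) set set)"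
  proof -
    have "lattice_edges \<subseteq> (\<lambda>(u, w). {u, w}) ` (UNIV :: ((int ^ 'd) \<times> (int ^ 'd)) set)"
      by (auto simp: lattice_edges_def)
    moreover have "countable ((\<lambda>(u, w). {u, w}) ` (UNIV :: ((int ^ 'd) \<times> (int ^ 'd)) set))"
      by (intro countable_image countableI_type)
    ultimately show ?thesis by (rule countable_subset)
  qed
  moreover have "AE x in edge_measure a b p. x e = a \<or> x e = b"
    if "e \<in> lattice_edges" for e :: "(int ^ 'd) set"
    unfolding edge_measure_def using ab p_pos p_less_1 that
    by (intro AE_PiM_component prob_space_two_point_measure AE_two_point) auto
  ultimately show ?thesis by (subst AE_ball_countable) auto
qed

end

section \<open>Averaging over translates and concentration\<close>

locale two_point_percolation = two_weights a b + bernoulli_cube p for a b p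
begin

lemma D_T_nonneg: "0 \<le> D e (T u w) A"
  using T_mono[of "A - {e}" "insert e A" u w] by (auto simp: D_def)

lemma D_T_le_geodesic:
  assumes "geodesic u w (A - {e}) ws"
  shows "D e (T u w) A \<le> (b - a) * of_bool (e \<in> set (path_edges ws))"
  using T_insert_le[OF assms, of e] by (simp add: D_def)

lemma D_T_le: "D e (T u w) A \<le> b - a"
proof -
  obtain ws where "geodesic u w (A - {e}) ws" using geodesic_exists by blast
  from D_T_le_geodesic[OF this] show ?thesis
    using a_less_b by (cases "e \<in> set (path_edges ws)") auto
qed

lemma D_T_reach: "D e (T u w) (A \<inter> reach u w) = D e (T u w) A"
proof -
  have "insert e (A \<inter> reach u w) \<inter> reach u w = insert e A \<inter> reach u w"
    "(A \<inter> reach u w - {e}) \<inter> reach u w = (A - {e}) \<inter> reach u w" by auto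
  then show ?thesis unfolding D_def by (metis T_reach)
qed

lemma sum_D_T_le:
  assumes "finite S"
  shows "(\<Sum>e\<in>S - A. D e (T u w) A) \<le> (b - a) * (b / a) * real_of_int (l1_norm (u - w))"
proof -
  obtain ws where ws: "geodesic u w A ws" using geodesic_exists by blast
  let ?P = "set (path_edges ws)"
  have "(\<Sum>e\<in>S - A. D e (T u w) A) \<le> (\<Sum>e\<in>S - A. (b - a) * of_bool (e \<in> ?P))"
  proof (rule sum_mono)
    fix e assume "e \<in> S - A"
    then have "A - {e} = A" by auto
    then show "D e (T u w) A \<le> (b - a) * of_bool (e \<in> ?P)"
      using D_T_le_geodesic[of u w A e ws] ws by simp
  qed
  also have "\<dots> = (b - a) * real (card ((S - A) \<inter> ?P))"
    using assms by (simp add: sum_distrib_left[symmetric] Int_def)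
  also have "\<dots> \<le> (b - a) * (b / a * real_of_int (l1_norm (u - w)))"
  proof (rule mult_left_mono)
    have "card ((S - A) \<inter> ?P) \<le> card ?P" by (intro card_mono) auto
    then have "card ((S - A) \<inter> ?P) \<le> length (path_edges ws)"
      using card_length order_trans by blast
    then have "a * real (card ((S - A) \<inter> ?P)) \<le> a * real (length (path_edges ws))"
      using a_pos by (intro mult_left_mono) auto
    then have "a * real (card ((S - A) \<inter> ?P)) \<le> b * real_of_int (l1_norm (u - w))"
      using geodesic_length[OF ws] by (rule order_trans)
    then show "real (card ((S - A) \<inter> ?P)) \<le> b / a * real_of_int (l1_norm (u - w))"
      using a_pos by (simp add: field_simps)
  qed (use a_less_b in simp)
  finally show ?thesis by (simp add: mult.assoc)
qed

text \<open>
  If an edge of weight \<open>a\<close> has nonzero influence, it lies on a geodesic \<open>ws\<close> chosen beforehand. If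
  this holds for the translate of \<open>e\<close> by \<open>- z\<close>, then \<open>ws\<close> visits \<open>y - z\<close>, where \<open>y\<close> is a fixed end
  point of \<open>e\<close>. So the number of nonzero terms is at most the number of vertices of \<open>ws\<close> in a
  reflected translate of \<open>Z\<close>.
\<close>
lemma sum_D_T_shift_le:
  fixes u w :: "int ^ 'd::finite"
  assumes Z: "finite Z" and diam: "\<And>z z'. z \<in> Z \<Longrightarrow> z' \<in> Z \<Longrightarrow> real_of_int (l1_norm (z - z')) \<le> r"
    and r: "0 \<le> r" and e: "e \<in> lattice_edges"
  shows "(\<Sum>z\<in>Z. if shift (- z) e \<in> A then 0 else D (shift (- z) e) (T u w) A)
    \<le> (b - a) * (b / a * r + 1)"
proof -
  obtain ws where ws: "geodesic u w A ws" using geodesic_exists by blast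
  obtain y where y: "y \<in> e" using e by (auto simp: lattice_edges_def)
  define R where "R = (\<lambda>z. y - z) ` Z"
  have inj: "inj_on (\<lambda>z. y - z) U" for U :: "(int ^ 'd) set" by (auto simp: inj_on_def)
  have "(\<Sum>z\<in>Z. if shift (- z) e \<in> A then 0 else D (shift (- z) e) (T u w) A)
      \<le> (\<Sum>z\<in>Z. (b - a) * of_bool (y - z \<in> set ws))"
  proof (rule sum_mono)
    fix z
    have "D (shift (- z) e) (T u w) A \<le> (b - a) * of_bool (y - z \<in> set ws)"
      if "shift (- z) e \<notin> A"
    proof -
      have "D (shift (- z) e) (T u w) A \<le> (b - a) * of_bool (shift (- z) e \<in> set (path_edges ws))"
        using D_T_le_geodesic[of u w A "shift (- z) e" ws] ws that by simp
      also have "\<dots> \<le> (b - a) * of_bool (y - z \<in> set ws)"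
      proof (rule mult_left_mono)
        have "y - z \<in> shift (- z) e" using y unfolding shift_def by force
        then show "of_bool (shift (- z) e \<in> set (path_edges ws)) \<le> (of_bool (y - z \<in> set ws) :: real)"
          using path_edge_subset_vertices[of "shift (- z) e" ws] by auto
      qed (use a_less_b in simp)
      finally show ?thesis .
    qed
    then show "(if shift (- z) e \<in> A then 0 else D (shift (- z) e) (T u w) A)
        \<le> (b - a) * of_bool (y - z \<in> set ws)"
      using a_less_b by auto
  qed
  also have "\<dots> = (b - a) * real (card {z \<in> Z. y - z \<in> set ws})"
    using Z by (simp add: sum_distrib_left[symmetric] Int_def)
  also have "card {z \<in> Z. y - z \<in> set ws} = card (set ws \<inter> R)"
  proof -
    have "set ws \<inter> R = (\<lambda>z. y - z) ` {z \<in> Z. y - z \<in> set ws}" by (auto simp: R_def)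
    then show ?thesis by (simp add: card_image[OF inj])
  qed
  also have "(b - a) * real (card (set ws \<inter> R)) \<le> (b - a) * (b / a * r + 1)"
  proof (rule mult_left_mono[OF geodesic_vertices_card[OF ws _ r]])
    fix x x' assume "x \<in> R" "x' \<in> R"
    then obtain z z' where z: "z \<in> Z" "z' \<in> Z" "x = y - z" "x' = y - z'" by (auto simp: R_def)
    then have "x - x' = z' - z" by simp
    then show "real_of_int (l1_norm (x - x')) \<le> r" using diam z by simp
  qed (use a_less_b in simp)
  finally show ?thesis .
qed

text \<open>
  By \<open>T_translate\<close> the summand is the passage time from \<open>z\<close> to \<open>v + z\<close>. Writing it with a
  translated configuration makes its law visibly independent of \<open>z\<close>.
\<close>
definition averaged_time :: "(int ^ 'd::finite) set \<Rightarrow> int ^ 'd \<Rightarrow> (int ^ 'd) set set \<Rightarrow> real" where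
  "averaged_time Z v A = (\<Sum>z\<in>Z. T 0 v (shift z -` A)) / real (card Z)"

lemma shift_inverse [simp]: "shift z (shift (- z) e) = e" "shift (- z) (shift z e) = e"
  by (auto simp: shift_def image_image)

lemma shift_eq_iff: "shift z e' = e \<longleftrightarrow> e' = shift (- z) e"
  by (metis shift_inverse)

lemma shift_vimage_insert: "shift z -` insert e A = insert (shift (- z) e) (shift z -` A)"
  by (rule set_eqI) (simp add: shift_eq_iff)

lemma shift_vimage_remove: "shift z -` (A - {e}) = shift z -` A - {shift (- z) e}"
  by (rule set_eqI) (simp add: shift_eq_iff)

lemma D_averaged_time:
  "D e (averaged_time Z v) A
    = (\<Sum>z\<in>Z. D (shift (- z) e) (T 0 v) (shift z -` A)) / real (card Z)"
  by (simp add: D_def averaged_time_def shift_vimage_insert shift_vimage_remove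
      sum_subtractf diff_divide_distrib)

text \<open>
  A finite set of edges that determines all the passage times from \<open>z\<close> to \<open>v + z\<close>.
\<close>
definition support :: "(int ^ 'd::finite) set \<Rightarrow> int ^ 'd \<Rightarrow> (int ^ 'd) set set" where
  "support Z v = (\<Union>z\<in>Z. shift z ` reach 0 v)"

lemma finite_support: "finite Z \<Longrightarrow> finite (support Z v)"
  by (simp add: support_def finite_reach)

lemma shift_lattice_edge: "e \<in> lattice_edges \<Longrightarrow> shift z e \<in> lattice_edges"
  by (subst (asm) lattice_edges_def) (auto simp: shift_def lattice_edge_iff)

lemma support_subset: "support Z v \<subseteq> lattice_edges"
  using reach_subset shift_lattice_edge by (fastforce simp: support_def)

text \<open>
  The influence of \<open>e\<close> on the passage time translated by \<open>z\<close> has the same expectation as the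
  influence of the edge translated by \<open>- z\<close> on the original passage time. Hence the sum over \<open>z\<close>
  can be taken inside one expectation, where \<open>sum_D_T_shift_le\<close> applies to a single configuration.
\<close>
lemma influence_le:
  fixes v :: "int ^ 'd::finite"
  assumes Z: "finite Z" and diam: "\<And>z z'. z \<in> Z \<Longrightarrow> z' \<in> Z \<Longrightarrow> real_of_int (l1_norm (z - z')) \<le> r"
    and r: "0 \<le> r" and e: "e \<in> lattice_edges"
  shows "E (support Z v) (D e (averaged_time Z v))
    \<le> (b - a) * (b / a * r + 1) / (1 - p) / real (card Z)"
proof -
  let ?S = "support Z v" and ?R = "reach 0 v"
  have "E ?S (\<lambda>A. D (shift (- z) e) (T 0 v) (shift z -` A))
      \<le> 1 / (1 - p) * E ?R (\<lambda>A. if shift (- z) e \<in> A then 0 else D (shift (- z) e) (T 0 v) A)"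
    if z: "z \<in> Z" for z
  proof -
    have fin: "finite (shift z -` ?S)"
      using finite_support[OF Z] bij_shift[of z] by (intro finite_vimageI) (auto simp: bij_def)
    have sub: "?R \<subseteq> shift z -` ?S" using z by (auto simp: support_def)
    have "E ?S (\<lambda>A. D (shift (- z) e) (T 0 v) (shift z -` A))
        = E (shift z -` ?S) (D (shift (- z) e) (T 0 v))"
      by (rule E_vimage[OF bij_shift])
    also have "\<dots> = E ?R (D (shift (- z) e) (T 0 v))"
      by (intro E_superset fin sub D_T_reach)
    also have "\<dots> \<le> 1 / (1 - p) * E ?R (\<lambda>A. if shift (- z) e \<in> A then 0 else D (shift (- z) e) (T 0 v) A)"
      by (rule E_le_E_absent[OF finite_reach]) (auto simp: D_T_nonneg, simp add: D_def)
    finally show ?thesis .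
  qed
  then have "(\<Sum>z\<in>Z. E ?S (\<lambda>A. D (shift (- z) e) (T 0 v) (shift z -` A)))
      \<le> (\<Sum>z\<in>Z. 1 / (1 - p) * E ?R (\<lambda>A. if shift (- z) e \<in> A then 0 else D (shift (- z) e) (T 0 v) A))"
    by (rule sum_mono)
  also have "\<dots> = 1 / (1 - p) * E ?R (\<lambda>A. \<Sum>z\<in>Z. if shift (- z) e \<in> A then 0 else D (shift (- z) e) (T 0 v) A)"
    by (simp add: E_sum sum_distrib_left)
  also have "\<dots> \<le> 1 / (1 - p) * E ?R (\<lambda>A. (b - a) * (b / a * r + 1))"
    using p_less_1 by (intro mult_left_mono E_mono sum_D_T_shift_le Z diam r e) auto
  also have "\<dots> = (b - a) * (b / a * r + 1) / (1 - p)"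
    by (simp add: E_const finite_reach)
  finally have *: "(\<Sum>z\<in>Z. E ?S (\<lambda>A. D (shift (- z) e) (T 0 v) (shift z -` A)))
      \<le> (b - a) * (b / a * r + 1) / (1 - p)" .
  have "E ?S (D e (averaged_time Z v))
      = E ?S (\<lambda>A. 1 / real (card Z) * (\<Sum>z\<in>Z. D (shift (- z) e) (T 0 v) (shift z -` A)))"
    by (intro E_cong) (simp add: D_averaged_time)
  also have "\<dots> = (\<Sum>z\<in>Z. E ?S (\<lambda>A. D (shift (- z) e) (T 0 v) (shift z -` A))) / real (card Z)"
    unfolding E_cmult E_sum by simp
  also have "\<dots> \<le> (b - a) * (b / a * r + 1) / (1 - p) / real (card Z)"
    using * by (intro divide_right_mono) auto
  finally show ?thesis .
qed

text \<open>
  Each of the two end points is moved by \<open>z\<close>, at a cost of at most \<open>b\<close> times the norm of \<open>z\<close>.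
\<close>
lemma averaged_time_close:
  assumes Z: "finite Z" "Z \<noteq> {}" and \<rho>: "\<And>z. z \<in> Z \<Longrightarrow> real_of_int (l1_norm z) \<le> \<rho>"
  shows "\<bar>T 0 v A - averaged_time Z v A\<bar> \<le> 2 * b * \<rho>"
proof -
  have b: "0 \<le> b" using a_pos a_less_b by simp
  have close: "\<bar>T 0 v A - T 0 v (shift z -` A)\<bar> \<le> 2 * b * \<rho>" if z: "z \<in> Z" for z
  proof -
    have bz: "b * real_of_int (l1_norm z) \<le> b * \<rho>" using \<rho>[OF z] b by (rule mult_left_mono)
    have neg: "l1_norm (- z) = l1_norm z" using l1_norm_minus_commute[of 0 z] by simp
    have eq: "T 0 v (shift z -` A) = T z (v + z) A" using T_translate[of 0 z v A] by simp
    have "T 0 z A \<le> b * \<rho>" "T z 0 A \<le> b * \<rho>" "T v (v + z) A \<le> b * \<rho>" "T (v + z) v A \<le> b * \<rho>"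
      using bz T_le_l1[of 0 z A] T_le_l1[of z 0 A] T_le_l1[of v "v + z" A] T_le_l1[of "v + z" v A]
      by (simp_all add: neg)
    moreover have "T 0 v A \<le> T 0 z A + (T z (v + z) A + T (v + z) v A)"
      using T_triangle[of 0 v A z] T_triangle[of z v A "v + z"] by linarith
    moreover have "T z (v + z) A \<le> T z 0 A + (T 0 v A + T v (v + z) A)"
      using T_triangle[of z "v + z" A 0] T_triangle[of 0 "v + z" A v] by linarith
    ultimately show ?thesis unfolding eq by linarith
  qed
  have c: "0 < real (card Z)" using Z by (simp add: card_gt_0_iff)
  have "\<bar>T 0 v A - averaged_time Z v A\<bar> = \<bar>\<Sum>z\<in>Z. T 0 v A - T 0 v (shift z -` A)\<bar> / real (card Z)"
    using c by (simp add: averaged_time_def sum_subtractf field_simps)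
  also have "\<dots> \<le> (\<Sum>z\<in>Z. 2 * b * \<rho>) / real (card Z)"
    using close by (intro divide_right_mono order_trans[OF sum_abs] sum_mono) auto
  also have "\<dots> = 2 * b * \<rho>" using c by simp
  finally show ?thesis .
qed

lemma D_averaged_time_bounds:
  assumes Z: "finite Z" "Z \<noteq> {}"
  shows "0 \<le> D e (averaged_time Z v) A" "D e (averaged_time Z v) A \<le> b - a"
proof -
  have c: "0 < real (card Z)" using Z by (simp add: card_gt_0_iff)
  show "0 \<le> D e (averaged_time Z v) A"
    unfolding D_averaged_time by (intro divide_nonneg_nonneg sum_nonneg D_T_nonneg) auto
  have "D e (averaged_time Z v) A \<le> (\<Sum>z\<in>Z. b - a) / real (card Z)"
    unfolding D_averaged_time by (intro divide_right_mono sum_mono D_T_le) auto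
  then show "D e (averaged_time Z v) A \<le> b - a" using c by simp
qed

lemma sum_D_averaged_time_le:
  assumes Z: "finite Z" "Z \<noteq> {}" and S: "finite S"
  shows "(\<Sum>e\<in>S - A. D e (averaged_time Z v) A) \<le> (b - a) * (b / a) * real_of_int (l1_norm v)"
proof -
  have c: "0 < real (card Z)" using Z by (simp add: card_gt_0_iff)
  have "(\<Sum>e\<in>S - A. D (shift (- z) e) (T 0 v) (shift z -` A))
      \<le> (b - a) * (b / a) * real_of_int (l1_norm v)" for z
  proof -
    have inj: "inj_on (shift z) U" for U using bij_shift[of z] by (auto simp: bij_def intro: inj_on_subset)
    have fin: "finite (shift z -` S)" using S inj[of UNIV] by (intro finite_vimageI)
    have "bij_betw (shift z) (shift z -` S - shift z -` A) (S - A)"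
      unfolding bij_betw_def vimage_Diff[symmetric] using inj bij_shift[of z]
      by (simp add: bij_def surj_image_vimage_eq)
    then have "(\<Sum>e\<in>S - A. D (shift (- z) e) (T 0 v) (shift z -` A))
        = (\<Sum>e\<in>shift z -` S - shift z -` A. D e (T 0 v) (shift z -` A))"
      by (subst sum.reindex_bij_betw[symmetric]) auto
    also have "\<dots> \<le> (b - a) * (b / a) * real_of_int (l1_norm (0 - v))"
      by (rule sum_D_T_le[OF fin])
    finally show ?thesis using l1_norm_minus_commute[of 0 v] by simp
  qed
  then have "(\<Sum>z\<in>Z. \<Sum>e\<in>S - A. D (shift (- z) e) (T 0 v) (shift z -` A)) / real (card Z)
      \<le> (\<Sum>z\<in>Z. (b - a) * (b / a) * real_of_int (l1_norm v)) / real (card Z)"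
    by (intro divide_right_mono sum_mono) auto
  also have "\<dots> = (b - a) * (b / a) * real_of_int (l1_norm v)" using c by simp
  finally show ?thesis
    unfolding D_averaged_time sum_divide_distrib[symmetric] by (subst sum.swap)
qed


text \<open>
  With \<open>m\<close> of order \<open>n\<close> to the power \<open>1/4\<close> and \<open>L = ln m\<close>, the term \<open>exp L * \<delta>\<close> of
  \<open>exp_variance_bound\<close> stays bounded, whereas \<open>L\<close> is at least \<open>ln n / 4\<close>. So the exponential moment
  of \<open>X\<close>, the centred averaged time, is bounded at \<open>s = \<theta> / \<sigma>\<close> for a constant \<open>\<theta>\<close>.
\<close>
theorem cube_concentration:
  assumes dim: "CARD('d::finite) \<ge> 2"
  shows "\<exists>C1>0. \<exists>C2>0. \<forall>v :: int ^ 'd. \<forall>t :: real. l1_norm v \<ge> 2 \<longrightarrow>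
    (\<exists>S. finite S \<and> S \<subseteq> lattice_edges \<and> reach 0 v \<subseteq> S \<and>
      E S (\<lambda>A. of_bool (t * sqrt (real_of_int (l1_norm v) / ln (real_of_int (l1_norm v)))
          < \<bar>T 0 v A - E S (T 0 v)\<bar>)) \<le> C1 * exp (- C2 * t))"
proof -
  define K0 where "K0 = (b - a) * (4 * b / a + 1) / (1 - p)"
  define K where "K = 324 * ((b - a) * (b / a)) / (1 - p) * (2 * (b - a) + K0)"
  \<comment> \<open>The first bound makes one flip change \<open>exp (s * X)\<close> by at most a factor \<open>exp 1\<close>; the second one gives \<open>K * \<theta>\<^sup>2 \<le> 2\<close>.\<close>
  define \<theta> where "\<theta> = min (1 / (b - a)) (1 / (K + 1))"
  have ba: "0 < b - a" "0 < b" using a_pos a_less_b by auto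
  have K0: "0 < K0" unfolding K0_def using ba a_pos p_less_1
    by (intro divide_pos_pos mult_pos_pos add_pos_pos) auto
  have K: "0 < K" unfolding K_def using ba a_pos p_less_1 K0
    by (intro divide_pos_pos mult_pos_pos add_pos_pos) auto
  have \<theta>: "0 < \<theta>" "\<theta> \<le> 1 / (b - a)" "\<theta> \<le> 1 / (K + 1)" using ba K by (auto simp: \<theta>_def)
  have K\<theta>: "K * \<theta>\<^sup>2 \<le> 2"
  proof -
    have "\<theta> + K * \<theta> \<le> 1" "0 < K * \<theta>" using \<theta>(3) K \<theta>(1) by (simp_all add: field_simps)
    then have "\<theta> \<le> 1" "K * \<theta> \<le> 1" using \<theta>(1) by linarith+
    then have "(K * \<theta>) * \<theta> \<le> 1 * 1" using \<theta>(1) K by (intro mult_mono) auto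
    then show ?thesis by (simp add: power2_eq_square mult.assoc)
  qed
  show ?thesis
  proof (rule exI[of _ "2 * exp 2 * exp (32 * b * \<theta>)"], intro conjI, simp,
      rule exI[of _ \<theta>], intro conjI \<theta>(1) allI impI)
    fix v :: "int ^ 'd" and t :: real
    assume v: "l1_norm v \<ge> 2"
    define n where "n = real_of_int (l1_norm v)"
    define \<sigma> where "\<sigma> = sqrt (n / ln n)"
    \<comment> \<open>The side \<open>m\<close> has to be a power of \<open>n\<close> for the logarithmic gain and at most of order \<open>\<sigma>\<close> for the approximation.\<close>
    define q where "q = sqrt (sqrt n)"
    define m where "m = nat \<lceil>q\<rceil>"
    have n: "2 \<le> n" using v by (simp add: n_def)
    have ln_n: "0 < ln n" "ln n \<le> n" using n ln_le_minus_one[of n] by (auto simp: ln_gt_zero)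
    have \<sigma>1: "1 \<le> \<sigma>" unfolding \<sigma>_def using ln_n by simp
    have \<sigma>2: "\<sigma>\<^sup>2 = n / ln n" unfolding \<sigma>_def using n ln_n by simp
    have q4: "(q\<^sup>2)\<^sup>2 = n" unfolding q_def using n by simp
    have q1: "1 \<le> q" unfolding q_def using n by simp
    have ln_q: "ln n = 4 * ln q" using q1 by (simp add: q4[symmetric] ln_realpow)
    have qm: "q \<le> real m" "real m \<le> 2 * q" unfolding m_def using q1 by linarith+
    have m0: "0 < m" using qm q1 by (cases m) auto
    have q\<sigma>: "q \<le> 2 * \<sigma>"
    proof -
      have "q * 1 \<le> q * q" using q1 by (intro mult_left_mono) auto
      moreover have "ln q \<le> q" using q1 ln_le_minus_one[of q] by simp
      ultimately have "ln n \<le> 4 * q\<^sup>2" using ln_q by (simp add: power2_eq_square)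
      then have "q\<^sup>2 * ln n \<le> q\<^sup>2 * (4 * q\<^sup>2)" by (intro mult_left_mono) auto
      also have "\<dots> = 4 * n" unfolding q4[symmetric] by (simp add: power2_eq_square)
      finally have "q\<^sup>2 \<le> 4 * (n / ln n)" using ln_n by (simp add: field_simps)
      then have "q\<^sup>2 \<le> (2 * \<sigma>)\<^sup>2" by (simp add: power_mult_distrib \<sigma>2)
      then show ?thesis by (rule power2_le_imp_le) (use \<sigma>1 in simp)
    qed
    obtain Z :: "(int ^ 'd) set" where Z: "finite Z" "card Z = m * m"
      "\<And>z. z \<in> Z \<Longrightarrow> l1_norm z \<le> 2 * int m" "0 \<in> Z"
      using planar_box[OF dim, of m] m0 by blast
    have Zne: "Z \<noteq> {}" using Z(4) by auto
    have \<rho>: "real_of_int (l1_norm z) \<le> 2 * real m" if "z \<in> Z" for z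
      using Z(3)[OF that] by linarith
    have diam: "real_of_int (l1_norm (z - z')) \<le> 4 * real m" if "z \<in> Z" "z' \<in> Z" for z z'
    proof -
      have "l1_norm (z - z') \<le> l1_norm z + l1_norm (- z')" using l1_norm_triangle[of z "- z'"] by simp
      also have "l1_norm (- z') = l1_norm z'" using l1_norm_minus_commute[of 0 z'] by simp
      finally show ?thesis using Z(3)[OF that(1)] Z(3)[OF that(2)] by linarith
    qed
    define S where "S = support Z v"
    have S: "finite S" "S \<subseteq> lattice_edges"
      using finite_support[OF Z(1)] support_subset by (auto simp: S_def)
    have reach: "reach 0 v \<subseteq> S"
    proof -
      have "shift 0 ` reach 0 v \<subseteq> S" using Z(4) by (auto simp: S_def support_def)
      then show ?thesis by (simp add: shift_def)
    qed
    define X where "X = (\<lambda>A. averaged_time Z v A - E S (averaged_time Z v))"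
    have DX: "D e X = D e (averaged_time Z v)" for e by (simp add: X_def D_def fun_eq_iff)
    have mean: "E S X = 0" unfolding X_def E_diff using S(1) by (simp add: E_const)
    have infl: "E S (D e X) \<le> K0 / real m" if "e \<in> S" for e
    proof -
      have "E S (D e X) \<le> (b - a) * (b / a * (4 * real m) + 1) / (1 - p) / real (card Z)"
        unfolding DX S_def using that S by (intro influence_le Z(1) diam) auto
      also have "\<dots> \<le> (b - a) * ((4 * b / a + 1) * real m) / (1 - p) / real (card Z)"
        using ba p_less_1 m0 by (intro divide_right_mono mult_left_mono) (auto simp: algebra_simps)
      also have "\<dots> = K0 / real m" 
      proof -
        have "x * (y * real m) / w / (real m * real m) = x * y / w / real m" for x y w :: real
          using m0 by simp
        then show ?thesis unfolding Z(2) K0_def of_nat_mult .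
      qed
      finally show ?thesis .
    qed
    have var: "Var S (\<lambda>A. exp (s * X A)) \<le> K * \<sigma>\<^sup>2 * s\<^sup>2 * E S (\<lambda>A. exp (2 * s * X A))"
      if s: "\<bar>s\<bar> \<le> 1 / (b - a)" for s
    proof -
      define Q where "Q = E S (\<lambda>A. exp (2 * s * X A))"
      define V where "V = Var S (\<lambda>A. exp (s * X A))"
      have Q: "0 \<le> Q" unfolding Q_def by (intro E_nonneg) auto
      have exp_ln: "exp (ln (real m)) = real m" using m0 by simp
      have "ln (real m) * V \<le> 81 * ((b - a) * (b / a) * n) / (1 - p)
          * (2 * (b - a) + exp (ln (real m)) * (K0 / real m)) * s\<^sup>2 * Q"
        unfolding Q_def V_def
      proof (rule exp_variance_bound[OF S(1)])
        show "\<bar>s\<bar> * (b - a) \<le> 1" using s ba by (simp add: field_simps)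
        show "(\<Sum>e\<in>S - A. D e X A) \<le> (b - a) * (b / a) * n" for A
          unfolding DX n_def by (rule sum_D_averaged_time_le[OF Z(1) Zne S(1)])
      qed (use infl K0 ba in \<open>auto simp: DX D_averaged_time_bounds[OF Z(1) Zne]\<close>)
      then have "ln (real m) * V \<le> 81 * ((b - a) * (b / a) * n) / (1 - p) * (2 * (b - a) + K0) * s\<^sup>2 * Q"
        using m0 unfolding exp_ln by simp
      moreover have "81 * (x * n) / w * y = 324 * x / w * y / 4 * n" for x w y by simp
      ultimately have 1: "ln (real m) * V \<le> K / 4 * n * s\<^sup>2 * Q"
        unfolding K_def by metis
      have V0: "0 \<le> V"
        unfolding V_def Var_def
        using E_Cauchy_Schwarz[of S "\<lambda>_. 1" "\<lambda>A. exp (s * X A)" "\<lambda>_. 1"] S(1) by (simp add: E_const)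
      have "ln n / 4 \<le> ln (real m)" unfolding ln_q using qm q1 by simp
      then have "ln n / 4 * V \<le> ln (real m) * V" using V0 by (rule mult_right_mono)
      with 1 have "ln n * V \<le> K * n * s\<^sup>2 * Q" by simp
      then show ?thesis unfolding V_def Q_def \<sigma>2 using ln_n by (simp add: field_simps)
    qed
    define s where "s = \<theta> / \<sigma>"
    have s0: "0 < s" using \<theta> \<sigma>1 by (simp add: s_def)
    have "s \<le> \<theta>" unfolding s_def using \<theta>(1) \<sigma>1 by (simp add: field_simps)
    then have s_le: "s \<le> 1 / (b - a)" using \<theta>(2) by linarith
    have Ks: "K * \<sigma>\<^sup>2 * s\<^sup>2 \<le> 2" using K\<theta> \<sigma>1 by (simp add: s_def power_divide)
    have mgf: "E S (\<lambda>A. exp (s' * X A)) \<le> exp 2" if s': "s' = s \<or> s' = - s" for s'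
    proof -
      have sq: "s'\<^sup>2 = s\<^sup>2" using s' by auto
      have "E S (\<lambda>A. exp (s' * X A)) \<le> exp (K * \<sigma>\<^sup>2 * s'\<^sup>2)"
      proof (rule exp_moment_bound[OF S(1) mean _ var])
        show "\<bar>s'\<bar> \<le> 1 / (b - a)" using s' s0 s_le by auto
      qed (use K Ks sq in auto)
      also have "\<dots> \<le> exp 2" using Ks sq by simp
      finally show ?thesis .
    qed
    have close: "\<bar>T 0 v A - averaged_time Z v A\<bar> \<le> 2 * b * (2 * real m)" for A
      by (rule averaged_time_close[OF Z(1) Zne \<rho>])
    have "\<bar>E S (T 0 v) - E S (averaged_time Z v)\<bar> \<le> E S (\<lambda>A. \<bar>T 0 v A - averaged_time Z v A\<bar>)"
      unfolding E_diff[symmetric] by (rule E_abs)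
    also have "\<dots> \<le> E S (\<lambda>A. 2 * b * (2 * real m))" by (rule E_mono[OF close])
    also have "\<dots> = 2 * b * (2 * real m)" using S(1) by (rule E_const)
    finally have close_mean: "\<bar>E S (T 0 v) - E S (averaged_time Z v)\<bar> \<le> 2 * b * (2 * real m)" .
    \<comment> \<open>The averaging costs \<open>4 * b * m\<close> pointwise and the same amount in the mean; \<open>r\<close> may be negative.\<close>
    define r where "r = t * \<sigma> - 8 * b * real m"
    have "E S (\<lambda>A. of_bool (t * \<sigma> < \<bar>T 0 v A - E S (T 0 v)\<bar>)) \<le> E S (\<lambda>A. of_bool (r < \<bar>X A\<bar>))"
    proof (rule E_mono)
      fix A
      have "r < \<bar>X A\<bar>" if "t * \<sigma> < \<bar>T 0 v A - E S (T 0 v)\<bar>"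
        using that close[of A] close_mean unfolding r_def X_def by linarith
      then show "(of_bool (t * \<sigma> < \<bar>T 0 v A - E S (T 0 v)\<bar>) :: real) \<le> of_bool (r < \<bar>X A\<bar>)"
        by auto
    qed
    also have "\<dots> \<le> exp (- (s * r)) * (E S (\<lambda>A. exp (s * X A)) + E S (\<lambda>A. exp (- s * X A)))"
      by (rule Chernoff_bound[OF S(1) s0])
    also have "\<dots> \<le> exp (- (s * r)) * (exp 2 + exp 2)"
      by (intro mult_left_mono add_mono mgf) auto
    also have "\<dots> \<le> exp (32 * b * \<theta> - \<theta> * t) * (exp 2 + exp 2)"
    proof (rule mult_right_mono)
      have "\<theta> * (8 * b * real m) \<le> \<theta> * (8 * b * (4 * \<sigma>))"
        using qm q\<sigma> \<theta>(1) ba by (intro mult_left_mono) auto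
      then have "- (s * r) \<le> 32 * b * \<theta> - \<theta> * t"
        unfolding s_def r_def using \<sigma>1 by (simp add: field_simps)
      then show "exp (- (s * r)) \<le> exp (32 * b * \<theta> - \<theta> * t)" by simp
    qed simp
    also have "\<dots> = 2 * exp 2 * exp (32 * b * \<theta>) * exp (- \<theta> * t)"
      by (simp add: exp_diff exp_minus field_simps)
    finally show "\<exists>S. finite S \<and> S \<subseteq> lattice_edges \<and> reach 0 v \<subseteq> S \<and>
      E S (\<lambda>A. of_bool (t * sqrt (real_of_int (l1_norm v) / ln (real_of_int (l1_norm v)))
          < \<bar>T 0 v A - E S (T 0 v)\<bar>)) \<le> 2 * exp 2 * exp (32 * b * \<theta>) * exp (- \<theta> * t)"
      using S reach unfolding \<sigma>_def n_def by blast
  qed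
qed

end

theorem proposition5p10:
  fixes a b p :: real
  assumes "CARD('d::finite) \<ge> 2"
    and "0 < a" and "a < b" and "0 < p" and "p < 1"
  shows "\<exists>C1>0. \<exists>C2>0. \<forall>v :: int ^ 'd. \<forall>t :: real.
           l1_norm v \<ge> 2 \<longrightarrow> t > 0 \<longrightarrow>
           measure (edge_measure a b p)
             {x \<in> space (edge_measure a b p).
                \<bar>first_passage_time x 0 v
                   - (\<integral>y. first_passage_time y 0 v \<partial>edge_measure a b p)\<bar>
                > t * sqrt (real_of_int (l1_norm v) / ln (real_of_int (l1_norm v)))}
           \<le> C1 * exp (- C2 * t)"
proof -
  interpret two_point_percolation a b p
    using assms by (simp add: two_point_percolation_def two_weights_def bernoulli_cube_def)
  let ?M = "edge_measure a b p :: ((int ^ 'd) set \<Rightarrow> real) measure"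
  have ab: "0 \<le> a" "a < b" using assms by auto
  have prob: "prob_space ?M" using assms by (intro prob_space_edge_measure) auto
  have transfer: "measure ?M {x \<in> space ?M.
        \<bar>first_passage_time x 0 v - (\<integral>y. first_passage_time y 0 v \<partial>?M)\<bar> > r}
      = E S (\<lambda>A. of_bool (r < \<bar>T 0 v A - E S (T 0 v)\<bar>))"
    if S: "finite S" "S \<subseteq> lattice_edges" "reach 0 v \<subseteq> S" for S and v :: "int ^ 'd" and r
  proof -
    have ae: "AE x in ?M. first_passage_time x 0 v = T 0 v {e \<in> S. x e = b}"
    proof (rule AE_mp[OF AE_edge_weight[OF ab]], intro AE_I2 impI)
      fix x :: "(int ^ 'd) set \<Rightarrow> real"
      assume x: "\<forall>e\<in>lattice_edges. x e = a \<or> x e = b"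
      \<comment> \<open>The configuration on all edges gives the passage time; only its part in \<open>reach 0 v\<close> matters.\<close>
      let ?A = "{e \<in> lattice_edges. x e = b}"
      have "sum_list (map x (path_edges ws)) = cost ?A ws" if "lattice_path 0 v ws" for ws
      proof -
        have "set (path_edges ws) \<subseteq> lattice_edges"
          using that path_edges_in_lattice_edges unfolding lattice_path_def by blast
        then show ?thesis unfolding cost_def weight_def using x
          by (intro arg_cong[of _ _ sum_list] map_cong) auto
      qed
      then have "first_passage_time x 0 v = T 0 v ?A"
        unfolding T_eq_Inf first_passage_time_def by (intro arg_cong[of _ _ Inf] image_cong) auto
      also have "\<dots> = T 0 v {e \<in> S. x e = b}"
      proof -
        have "?A \<inter> reach 0 v = {e \<in> S. x e = b} \<inter> reach 0 v" using S by auto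
        from arg_cong[OF this, of "T 0 v"] show ?thesis unfolding T_reach .
      qed
      finally show "first_passage_time x 0 v = T 0 v {e \<in> S. x e = b}" .
    qed
    note meas = integral_configuration(2)[OF ab S(1,2)]
    note int = integral_configuration(1)[OF ab S(1,2)]
    have mean: "(\<integral>y. first_passage_time y 0 v \<partial>?M) = E S (T 0 v)"
      unfolding int[symmetric]
      by (intro integral_cong_AE measurable_first_passage_time meas ae)
    let ?B = "{x \<in> space ?M. \<bar>first_passage_time x 0 v - E S (T 0 v)\<bar> > r}"
    have B: "?B \<in> sets ?M"
      using measurable_first_passage_time[of 0 v a b p] by measurable
    have "measure ?M ?B = (\<integral>x. indicator ?B x \<partial>?M)" using B by simp
    also have "\<dots> = (\<integral>x. of_bool (r < \<bar>T 0 v {e \<in> S. x e = b} - E S (T 0 v)\<bar>) \<partial>?M)"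
    proof (rule integral_cong_AE)
      show "AE x in ?M. (indicator ?B x :: real)
          = of_bool (r < \<bar>T 0 v {e \<in> S. x e = b} - E S (T 0 v)\<bar>)"
        using ae AE_space by eventually_elim (simp add: indicator_def)
    qed (use B meas[of "\<lambda>A. of_bool (r < \<bar>T 0 v A - E S (T 0 v)\<bar>)"] in auto)
    also have "\<dots> = E S (\<lambda>A. of_bool (r < \<bar>T 0 v A - E S (T 0 v)\<bar>))" by (rule int)
    finally show ?thesis unfolding mean .
  qed
  obtain C1 C2 where C: "C1 > 0" "C2 > 0"
    and bound: "\<forall>v :: int ^ 'd. \<forall>t :: real. l1_norm v \<ge> 2 \<longrightarrow>
      (\<exists>S. finite S \<and> S \<subseteq> lattice_edges \<and> reach 0 v \<subseteq> S \<and>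
        E S (\<lambda>A. of_bool (t * sqrt (real_of_int (l1_norm v) / ln (real_of_int (l1_norm v)))
          < \<bar>T 0 v A - E S (T 0 v)\<bar>)) \<le> C1 * exp (- C2 * t))"
    using cube_concentration[OF assms(1)] by (elim exE conjE)
  show ?thesis
  proof (rule exI[of _ C1], intro conjI C(1), rule exI[of _ C2], intro conjI C(2) allI impI)
    fix v :: "int ^ 'd" and t :: real
    assume "l1_norm v \<ge> 2"
    then obtain S where S: "finite S" "S \<subseteq> lattice_edges" "reach 0 v \<subseteq> S"
      and le: "E S (\<lambda>A. of_bool (t * sqrt (real_of_int (l1_norm v) / ln (real_of_int (l1_norm v)))
          < \<bar>T 0 v A - E S (T 0 v)\<bar>)) \<le> C1 * exp (- C2 * t)"
      using bound by (elim allE impE exE conjE)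
    show "measure ?M {x \<in> space ?M.
        \<bar>first_passage_time x 0 v - (\<integral>y. first_passage_time y 0 v \<partial>?M)\<bar>
          > t * sqrt (real_of_int (l1_norm v) / ln (real_of_int (l1_norm v)))}
      \<le> C1 * exp (- C2 * t)"
      unfolding transfer[OF S] by (rule le)
  qed
qed

end
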